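(* Let $\mathbb{X}$ be a Borel subset of some Polish space, let $q$ be a probability measure on $([\mathbb{X}],\mathscr{B}([\mathbb{X}]))$, and let $\rho$ be the exchangeable probability measure on $(\mathbb{X}^\infty,\mathscr{B}(\mathbb{X}^\infty))$ given by $\rho(C)=\int_{[\mathbb{X}]}\mathfrak{p}^\infty(C)\,q(\mathrm{d}\mathfrak{p})$ for $C\in\mathscr{B}(\mathbb{X}^\infty)$. Let $\mathrm{d}_{[[\mathbb{X}]]}$ be any metric on $[[\mathbb{X}]]$ metrizing weak convergence of probability measures on $[\mathbb{X}]$ and, for each $m\in\mathbb{N}\cup\{+\infty\}$, let $\mathrm{d}_{[\mathbb{X}^m]}$ be any metric on $[\mathbb{X}^m]$ metrizing weak convergence of probability measures on $\mathbb{X}^m$. Then $$\mathrm{d}_{[[\mathbb{X}]]}\big(q(\tilde{\boldsymbol{\xi}}^{(n)}),\delta_{\tilde{\mathfrak{e}}_n}\big)\to 0\quad\text{as } n\to+\infty\qquad(\rho\text{-a.s.})$$ and, for every $m\in\mathbb{N}\cup\{+\infty\}$, $$\mathrm{d}_{[\mathbb{X}^m]}\big(p_m(\tilde{\boldsymbol{\xi}}^{(n)}),\tilde{\mathfrak{e}}_n^m\big)\to 0\quad\text{as } n\to+\infty\qquad(\rho\text{-a.s.}).$$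
   Context: For a separable metrizable space $\mathbb{S}$ with Borel $\sigma$-algebra $\mathscr{B}(\mathbb{S})$, $[\mathbb{S}]$ denotes the set of all probability measures on $(\mathbb{S},\mathscr{B}(\mathbb{S}))$, endowed with the topology of weak convergence and its Borel $\sigma$-algebra; $[[\mathbb{S}]]$ is the set of probability measures on $[\mathbb{S}]$. $\mathbb{X}^m$ carries the product topology, also for $m=+\infty$, and $\mathfrak{p}^m$ is the $m$-fold product measure. $\tilde{\xi}_1,\tilde{\xi}_2,\dots$ are the coordinate random elements of $\mathbb{X}^\infty$ and $\tilde{\boldsymbol{\xi}}^{(n)}:=(\tilde{\xi}_1,\dots,\tilde{\xi}_n)$. The empirical measure is $\tilde{\mathfrak{e}}_n:=\frac1n\sum_{i=1}^n\delta_{\tilde{\xi}_i}$, and $\delta_{\tilde{\mathfrak{e}}_n}\in[[\mathbb{X}]]$ is the point mass at $\tilde{\mathfrak{e}}_n$. Under $\rho$ there is a random probability measure $\tilde{\mathfrak{p}}$ ($\mathscr{B}(\mathbb{X}^\infty)/\mathscr{B}([\mathbb{X}])$-measurable, $\rho$-a.s. unique) with distribution $q$ such that $\tilde{\mathfrak{e}}_n$ converges weakly to $\tilde{\mathfrak{p}}$, $\rho$-a.s. The posterior distribution $q(\tilde{\boldsymbol{\xi}}^{(n)})=q(\tilde{\boldsymbol{\xi}}^{(n)},\cdot)$ is a (fixed) regular conditional distribution of $\tilde{\mathfrak{p}}$ given $\tilde{\boldsymbol{\xi}}^{(n)}$ under $\rho$. The predictive distribution is $p_m(\tilde{\boldsymbol{\xi}}^{(n)},C):=\int_{[\mathbb{X}]}\mathfrak{p}^m(C)\,q(\tilde{\boldsymbol{\xi}}^{(n)},\mathrm{d}\mathfrak{p})$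 for $C\in\mathscr{B}(\mathbb{X}^m)$; it is a version of the conditional distribution of $(\tilde{\xi}_{n+1},\dots,\tilde{\xi}_{n+m})$ given $\tilde{\boldsymbol{\xi}}^{(n)}$. *)

theory Defs
  imports "HOL-Probability.Probability" "HOL-Library.Extended_Nat"
begin

definition borel_of :: "'a topology \<Rightarrow> 'a measure" where
  "borel_of T = sigma (topspace T) {U. openin T U}"

definition prob_measures :: "'a topology \<Rightarrow> 'a measure set" where
  "prob_measures T = {\<mu>. prob_space \<mu> \<and> sets \<mu> = sets (borel_of T)}"

text \<open>
  The topology of weak convergence on the probability measures on \<open>T\<close>: the coarsest topology
  making \<open>\<mu> \<mapsto> \<integral>f d\<mu>\<close> continuous for every bounded continuous real \<open>f\<close>.
\<close>

definition weak_topology :: "'a topology \<Rightarrow> 'a measure topology" where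
  "weak_topology T = topology_generated_by
     {{\<mu> \<in> prob_measures T. (\<integral>x. f x \<partial>\<mu>) \<in> U} | f U.
        continuous_map T euclideanreal f \<and> bounded (f ` topspace T) \<and> open (U :: real set)}"

definition metrizes :: "('a \<Rightarrow> 'a \<Rightarrow> real) \<Rightarrow> 'a topology \<Rightarrow> bool" where
  "metrizes d T \<longleftrightarrow>
     Metric_space (topspace T) d \<and> Metric_space.mtopology (topspace T) d = T"

text \<open>
  \<open>m\<close>-fold powers, for \<open>m \<in> \<nat> \<union> {\<infinity>}\<close>. A point of the power is a function on the index set
  \<open>{i. i < m}\<close>, so coordinates are numbered from 0.
\<close>

definition power_topology :: "'a topology \<Rightarrow> enat \<Rightarrow> (nat \<Rightarrow> 'a) topology" where
  "power_topology T m = product_topology (\<lambda>_. T) {i. enat i < m}"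

definition power_measure :: "'a measure \<Rightarrow> enat \<Rightarrow> (nat \<Rightarrow> 'a) measure" where
  "power_measure p m = PiM {i. enat i < m} (\<lambda>_. p)"

text \<open>
  The measure \<open>C \<mapsto> \<integral> p\<^sup>m(C) Q(dp)\<close> on the Borel sets of the \<open>m\<close>-fold power.
\<close>

definition mixture :: "'a topology \<Rightarrow> enat \<Rightarrow> 'a measure measure \<Rightarrow> (nat \<Rightarrow> 'a) measure" where
  "mixture T m Q =
     measure_of (topspace (power_topology T m)) (sets (borel_of (power_topology T m)))
       (\<lambda>C. \<integral>\<^sup>+ p. emeasure (power_measure p m) C \<partial>Q)"

text \<open>
  The empirical measure of the first \<open>n\<close> coordinates of \<open>x\<close>; meaningful for \<open>n \<ge> 1\<close> only.
\<close>

definition empirical :: "'a topology \<Rightarrow> nat \<Rightarrow> (nat \<Rightarrow> 'a) \<Rightarrow> 'a measure" where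
  "empirical T n x =
     measure_of (topspace T) (sets (borel_of T))
       (\<lambda>A. (\<Sum>i<n. emeasure (return (borel_of T) (x i)) A) / of_nat n)"

text \<open>
  \<open>\<kappa>\<close> is a regular conditional distribution under \<open>M\<close> of the \<open>S\<close>-valued random element \<open>Y\<close>
  given the \<open>N\<close>-valued random element \<open>Z\<close>: a probability kernel from \<open>N\<close> to \<open>S\<close> such that
  \<open>\<kappa>(Z, B)\<close> is a version of the conditional probability of \<open>{Y \<in> B}\<close> given \<open>\<sigma>(Z)\<close>.
\<close>

definition regular_cond_distr ::
  "'w measure \<Rightarrow> 'z measure \<Rightarrow> ('w \<Rightarrow> 'z) \<Rightarrow> 'y measure \<Rightarrow> ('w \<Rightarrow> 'y)
     \<Rightarrow> ('z \<Rightarrow> 'y measure) \<Rightarrow> bool" where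
  "regular_cond_distr M N Z S Y \<kappa> \<longleftrightarrow>
     \<kappa> \<in> N \<rightarrow>\<^sub>M prob_algebra S \<and>
     (\<forall>B\<in>sets S. AE \<omega> in M.
        measure (\<kappa> (Z \<omega>)) B =
          real_cond_exp M (vimage_algebra (space M) Z N) (indicator (Y -` B \<inter> space M)) \<omega>)"


lemma space_borel_of [simp]: "space (borel_of T) = topspace T"
  unfolding borel_of_def by (rule space_measure_of) (auto dest: openin_subset)

lemma sets_borel_of_top_of_set:
  fixes X :: "'a::topological_space set"
  assumes "X \<in> sets borel"
  shows "sets (borel_of (top_of_set X)) = sets (restrict_space borel X)"
proof -
  have "sets (restrict_space (borel :: 'a measure) X) =
      sigma_sets X ((\<inter>) X ` {S. open S})"
    unfolding sets_restrict_space sets_borel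
    by (rule sigma_sets_Int) (use assms in \<open>simp_all add: sets_borel\<close>)
  moreover have "(\<inter>) X ` {S. open S} = {U. openin (top_of_set X) U}"
    by (auto simp: openin_open)
  moreover have "sets (borel_of (top_of_set X)) = sigma_sets X {U. openin (top_of_set X) U}"
    unfolding borel_of_def topspace_euclidean_subtopology
    by (rule sets_measure_of) (auto dest: openin_imp_subset)
  ultimately show ?thesis
    by simp
qed

lemma emeasure_empirical:
  assumes A: "A \<in> sets (borel_of T)"
  shows "emeasure (empirical T n x) A =
    (\<Sum>i<n. emeasure (return (borel_of T) (x i)) A) / of_nat n"
proof (rule emeasure_measure_of[OF empirical_def])
  show "sets (borel_of T) \<subseteq> Pow (topspace T)"
    using sets.space_closed[of "borel_of T"] by simp
  show "A \<in> sets (empirical T n x)"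
    using A sets.sets_measure_of_eq[of "borel_of T"] by (simp add: empirical_def)
  show "positive (sets (empirical T n x))
      (\<lambda>A. (\<Sum>i<n. emeasure (return (borel_of T) (x i)) A) / of_nat n)"
    by (simp add: positive_def)
  show "countably_additive (sets (empirical T n x))
      (\<lambda>A. (\<Sum>i<n. emeasure (return (borel_of T) (x i)) A) / of_nat n)"
  proof (rule countably_additiveI)
    fix B :: "nat \<Rightarrow> 'a set"
    assume "range B \<subseteq> sets (empirical T n x)" and disj: "disjoint_family B"
    then have B: "range B \<subseteq> sets (borel_of T)"
      using sets.sets_measure_of_eq[of "borel_of T"] by (simp add: empirical_def)
    have "(\<Sum>k. (\<Sum>i<n. emeasure (return (borel_of T) (x i)) (B k)) / of_nat n) =
        (\<Sum>k. \<Sum>i<n. emeasure (return (borel_of T) (x i)) (B k)) / of_nat n"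
      by (rule ennreal_suminf_divide)
    also have "\<dots> = (\<Sum>i<n. \<Sum>k. emeasure (return (borel_of T) (x i)) (B k)) / of_nat n"
      by (subst suminf_sum) auto
    also have "\<dots> = (\<Sum>i<n. emeasure (return (borel_of T) (x i)) (\<Union>k. B k)) / of_nat n"
      using B disj by (simp add: suminf_emeasure del: emeasure_return)
    finally show "(\<Sum>k. (\<Sum>i<n. emeasure (return (borel_of T) (x i)) (B k)) / of_nat n) =
        (\<Sum>i<n. emeasure (return (borel_of T) (x i)) (\<Union>k. B k)) / of_nat n" .
  qed
qed

lemma topspace_weak_topology [simp]: "topspace (weak_topology T) = prob_measures T"
proof -
  let ?S = "{{\<mu> \<in> prob_measures T. (\<integral>x. f x \<partial>\<mu>) \<in> U} | f U.
        continuous_map T euclideanreal f \<and> bounded (f ` topspace T) \<and> open (U :: real set)}"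
  have "bounded ((\<lambda>_. 0 :: real) ` topspace T)"
    by (rule bounded_subset[of "{0}"]) auto
  then have "prob_measures T \<in> ?S"
    by (intro CollectI exI[of _ "\<lambda>_. 0"] exI[of _ UNIV]) simp
  then have "\<Union>?S = prob_measures T"
    by (intro equalityI Union_upper) auto
  then show ?thesis
    by (simp only: weak_topology_def topology_generated_by_topspace)
qed

lemma limitin_weak_topology:
  "limitin (weak_topology T) \<mu> \<nu> F \<longleftrightarrow>
     \<nu> \<in> prob_measures T \<and> eventually (\<lambda>n. \<mu> n \<in> prob_measures T) F \<and>
     (\<forall>f. continuous_map T euclideanreal f \<and> bounded (f ` topspace T) \<longrightarrow>
        ((\<lambda>n. \<integral>x. f x \<partial>\<mu> n) \<longlongrightarrow> (\<integral>x. f x \<partial>\<nu>)) F)" (is "?L \<longleftrightarrow> ?R")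
proof
  assume L: ?L
  have 1: "eventually (\<lambda>n. \<mu> n \<in> prob_measures T) F"
    using L openin_topspace[of "weak_topology T"] by (auto simp: limitin_def)
  have 2: "((\<lambda>n. \<integral>x. f x \<partial>\<mu> n) \<longlongrightarrow> (\<integral>x. f x \<partial>\<nu>)) F"
    if f: "continuous_map T euclideanreal f" "bounded (f ` topspace T)" for f
  proof (rule topological_tendstoI)
    fix U :: "real set" assume U: "open U" "(\<integral>x. f x \<partial>\<nu>) \<in> U"
    have "openin (weak_topology T) {\<mu> \<in> prob_measures T. (\<integral>x. f x \<partial>\<mu>) \<in> U}"
      unfolding weak_topology_def using f U(1) by (intro topology_generated_by_Basis) blast
    with L U(2) have "eventually (\<lambda>n. \<mu> n \<in> {\<mu> \<in> prob_measures T. (\<integral>x. f x \<partial>\<mu>) \<in> U}) F"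
      unfolding limitin_def topspace_weak_topology by blast
    then show "eventually (\<lambda>n. (\<integral>x. f x \<partial>\<mu> n) \<in> U) F"
      by (rule eventually_mono) auto
  qed
  show ?R using L 1 2 by (auto simp: limitin_def)
next
  assume R: ?R
  have "eventually (\<lambda>n. \<mu> n \<in> U) F"
    if "generate_topology_on {{\<mu> \<in> prob_measures T. (\<integral>x. f x \<partial>\<mu>) \<in> U} | f U.
        continuous_map T euclideanreal f \<and> bounded (f ` topspace T) \<and> open (U :: real set)} U"
      "\<nu> \<in> U" for U
    using that
  proof (induction rule: generate_topology_on.induct)
    case (Int a b)
    then show ?case by (auto intro: eventually_conj)
  next
    case (UN K)
    then obtain k where "k \<in> K" "\<nu> \<in> k" "eventually (\<lambda>n. \<mu> n \<in> k) F" by blast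
    then show ?case by (auto elim: eventually_mono)
  next
    case (Basis s)
    then obtain f and V :: "real set" where s: "s = {\<mu> \<in> prob_measures T. (\<integral>x. f x \<partial>\<mu>) \<in> V}"
      "continuous_map T euclideanreal f" "bounded (f ` topspace T)" "open V"
      by blast
    with R Basis(2) have "eventually (\<lambda>n. (\<integral>x. f x \<partial>\<mu> n) \<in> V) F"
      by (auto intro: topological_tendstoD)
    with R s(1) show ?case by (auto intro: eventually_conj)
  qed simp
  with R show ?L
    unfolding limitin_def topspace_weak_topology
    by (auto simp: weak_topology_def openin_topology_generated_by_iff)
qed

end

theory Submission
  imports Defs
begin

text \<open>
  Levy's zero-one law gives, for each Borel set \<open>B\<close> of laws, that the posterior mass of \<open>B\<close> tends
  a.s. to the indicator of \<open>ptilde \<in> B\<close>, because \<open>ptilde\<close> is a function of the whole sequence. The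
  weak topology is second countable, so applying this to a countable base shows that the posterior
  converges weakly to the point mass at \<open>ptilde\<close>; so does the point mass at the empirical measure.
  The map \<open>p \<mapsto> p\<^sup>m\<close> is weakly continuous, also for \<open>m = \<infinity>\<close>. Hence integrating \<open>p\<^sup>m\<close> against the
  posterior and taking the power of the empirical measure both converge to the power of \<open>ptilde\<close>.
\<close>

section \<open>Levy's zero-one law for events\<close>

text \<open>The obstacle is one of null sets. Weak convergence tests uncountably many functions,
  whereas the posterior is tied to conditional probabilities only up to a null set that depends on
  the event; so convergence must be decided by countably many events fixed in advance. For a point
  mass a countable base does this: only the base sets around \<open>ptilde x\<close> matter, and
  their posterior mass has to tend to 1. Second countability of the space of laws and continuity of
  powers rest on one device: indicators of open sets are approximated from below by functions
  \<open>1 - (\<Prod>j\<in>J. 1 - \<psi> j k x)\<close>, a soft union of bumps. Countably many of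
  these decide weak convergence, and being polynomial in the bumps they can be integrated term by
  term on product spaces. The two sequences in each claim are never compared directly. They share a
  limit, so the triangle inequality serves for every metric compatible with the topology.\<close>

lemma (in prob_space) integrable_indicator:
  "A \<in> sets M \<Longrightarrow> integrable M (indicator A :: 'a \<Rightarrow> real)"
  by (rule integrable_real_indicator) (auto simp: less_top[symmetric])

text \<open>The events that can be approximated form a sigma-algebra, hence the induction over
  \<open>sigma_sets\<close>. Complementation leaves the symmetric difference unchanged; a countable
  union is first cut to finitely many sets, whose approximants all live in one \<open>F m\<close>
  because the filtration increases. The tolerance is arbitrary in the induction since the union case
  calls for smaller ones.\<close>

lemma (in prob_space) sigma_sets_approximation:
  fixes F :: "nat \<Rightarrow> 'a measure"
  assumes F: "\<And>n. subalgebra M (F n)" "\<And>m n. m \<le> n \<Longrightarrow> sets (F m) \<subseteq> sets (F n)"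
    and gen: "sets M = sigma_sets (space M) (\<Union>n. sets (F n))"
    and A: "A \<in> sets M" and e: "0 < e"
  shows "\<exists>n. \<exists>B\<in>sets (F n). prob (sym_diff A B) < e"
proof -
  have space_F: "space (F n) = space M" and sub: "sets (F n) \<subseteq> sets M" for n
    using F(1)[of n] by (auto simp: subalgebra_def)
  from A have "A \<in> sigma_sets (space M) (\<Union>n. sets (F n))"
    by (simp add: gen)
  then show ?thesis
    using e
  proof (induction arbitrary: e)
    case (Basic a)
    then obtain n where "a \<in> sets (F n)" by blast
    with Basic show ?case by (intro exI[of _ n] bexI[of _ a]) auto
  next
    case Empty
    then show ?case by (intro exI[of _ 0] bexI[of _ "{}"]) auto
  next
    case (Compl a)
    have a: "a \<subseteq> space M"
      using Compl.hyps gen sets.sets_into_space by blast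
    obtain n B where B: "B \<in> sets (F n)" "prob (sym_diff a B) < e"
      using Compl.IH[OF Compl.prems] by blast
    have "B \<subseteq> space M"
      using B(1) sets.sets_into_space space_F by metis
    then have "sym_diff (space M - a) (space M - B) = sym_diff a B"
      using a by auto
    moreover have "space M - B \<in> sets (F n)"
      using B(1) space_F by (metis sets.compl_sets)
    ultimately show ?case
      using B(2) by (intro exI[of _ n] bexI[of _ "space M - B"]) auto
  next
    case (Union a)
    have a[measurable]: "a i \<in> sets M" for i
      using Union.hyps gen by blast
    have "(\<lambda>N. prob (\<Union>i<N. a i)) \<longlonglongrightarrow> prob (\<Union>N. \<Union>i<N. a i)"
      by (intro finite_Lim_measure_incseq monoI UN_mono) auto
    moreover have "(\<Union>N. \<Union>i<N. a i) = (\<Union>i. a i)"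
      by blast
    ultimately have "(\<lambda>N. prob (\<Union>i<N. a i)) \<longlonglongrightarrow> prob (\<Union>i. a i)"
      by simp
    then have "eventually (\<lambda>N. prob (\<Union>i. a i) - e / 2 < prob (\<Union>i<N. a i)) sequentially"
      using Union.prems by (intro order_tendstoD(1)) auto
    then obtain N where N: "prob (\<Union>i. a i) - e / 2 < prob (\<Union>i<N. a i)"
      by (auto simp: eventually_sequentially)
    \<comment> \<open>The \<open>N\<close> approximation errors together stay below
      \<open>e / 2\<close>, the other half being spent on the tail that was cut off; the
      \<open>+ 1\<close> covers \<open>N = 0\<close>.\<close>
    define e' where "e' = e / (2 * (real N + 1))"
    have e': "0 < e'" "N * e' < e / 2"
      using Union.prems by (auto simp: e'_def field_simps)
    have "\<forall>i. \<exists>n B. B \<in> sets (F n) \<and> prob (sym_diff (a i) B) < e'"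
      using Union.IH e'(1) by blast
    then obtain n B where B: "\<And>i. B i \<in> sets (F (n i))" "\<And>i. prob (sym_diff (a i) (B i)) < e'"
      by metis
    define m where "m = Max (insert 0 (n ` {..<N}))"
    have "n i \<le> m" if "i < N" for i
      using that by (auto simp: m_def intro!: Max_ge)
    then have "B i \<in> sets (F m)" if "i < N" for i
      using B(1)[of i] F(2)[of "n i" m] that by blast
    then have m: "(\<Union>i<N. B i) \<in> sets (F m)"
      by (intro sets.finite_UN) auto
    have [measurable]: "B i \<in> sets M" for i
      using B(1) sub by blast
    have "sym_diff (\<Union>i. a i) (\<Union>i<N. B i) \<subseteq>
        ((\<Union>i. a i) - (\<Union>i<N. a i)) \<union> (\<Union>i<N. sym_diff (a i) (B i))"
      by blast
    then have "prob (sym_diff (\<Union>i. a i) (\<Union>i<N. B i)) \<le>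
        prob (((\<Union>i. a i) - (\<Union>i<N. a i)) \<union> (\<Union>i<N. sym_diff (a i) (B i)))"
      by (rule finite_measure_mono) measurable
    also have "\<dots> \<le> prob ((\<Union>i. a i) - (\<Union>i<N. a i)) + prob (\<Union>i<N. sym_diff (a i) (B i))"
      by (rule measure_Un_le) measurable
    also have "prob ((\<Union>i. a i) - (\<Union>i<N. a i)) = prob (\<Union>i. a i) - prob (\<Union>i<N. a i)"
      by (rule finite_measure_Diff) (measurable, blast)
    also have "prob (\<Union>i<N. sym_diff (a i) (B i)) \<le> (\<Sum>i<N. prob (sym_diff (a i) (B i)))"
      by (rule finite_measure_subadditive_finite) auto
    also have "\<dots> \<le> (\<Sum>i<N. e')"
      using B(2) by (intro sum_mono less_imp_le)
    finally show ?case
      using N e'(2) m by (intro exI[of _ m] bexI[of _ "\<Union>i<N. B i"]) auto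
  qed
qed

text \<open>
  Decompose according to the first index at which the threshold is exceeded; \<open>disjointed\<close> does this.
\<close>

lemma (in prob_space) maximal_inequality_cond_prob:
  fixes F :: "nat \<Rightarrow> 'a measure" and c :: real
  assumes F: "\<And>n. subalgebra M (F n)" "\<And>m n. m \<le> n \<Longrightarrow> sets (F m) \<subseteq> sets (F n)"
    and D[measurable]: "D \<in> sets M"
  shows "c * prob {x \<in> space M. \<exists>k. c < real_cond_exp M (F k) (indicator D) x} \<le> prob D"
proof -
  define Y where "Y = (\<lambda>k. real_cond_exp M (F k) (indicator D))"
  define S where "S = (\<lambda>k. {x \<in> space M. c < Y k x})"
  have space_F: "space (F n) = space M" and sub: "sets (F n) \<subseteq> sets M" for n
    using F(1)[of n] by (auto simp: subalgebra_def)
  have SF: "S k \<in> sets (F k)" for k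
  proof -
    have [measurable]: "Y k \<in> borel_measurable (F k)"
      by (simp add: Y_def)
    have "{x \<in> space (F k). c < Y k x} \<in> sets (F k)"
      by measurable
    then show ?thesis by (simp add: S_def space_F)
  qed
  \<comment> \<open>First passage at time \<open>k\<close> is decided by the stages up to
    \<open>k\<close>, so the defining property of the conditional expectation given
    \<open>F k\<close> can be used on this event.\<close>
  have BF: "disjointed S k \<in> sets (F k)" for k
    unfolding disjointed_def using SF F(2)
    by (intro sets.Diff sets.finite_UN) (auto intro: less_imp_le subsetD)
  then have B[measurable]: "disjointed S k \<in> sets M" for k
    using sub by blast
  have le: "c * prob (disjointed S k) \<le> prob (D \<inter> disjointed S k)" for k
  proof -
    interpret G: finite_measure_subalgebra M "F k"
      by unfold_locales (rule F(1))
    note int = integrable_indicator[OF D]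
    have intY: "integrable M (Y k)"
      unfolding Y_def using int by (rule G.real_cond_exp_int)
    have "c * prob (disjointed S k) = (\<integral>x. indicator (disjointed S k) x * c \<partial>M)"
      by simp
    also have "\<dots> \<le> (\<integral>x. indicator (disjointed S k) x * Y k x \<partial>M)"
    proof (rule integral_mono)
      show "integrable M (\<lambda>x. indicator (disjointed S k) x * Y k x)"
        using integrable_mult_indicator[OF B intY, of k] by simp
      show "indicator (disjointed S k) x * c \<le> indicator (disjointed S k) x * Y k x" for x
        by (auto simp: indicator_def disjointed_def S_def)
    qed (simp add: integrable_indicator[OF B])
    also have "\<dots> = (\<integral>x. indicator (disjointed S k) x * indicator D x \<partial>M)"
      using G.real_cond_exp_intA[OF int BF] by (simp add: set_lebesgue_integral_def Y_def)
    also have "\<dots> = (\<integral>x. indicator (D \<inter> disjointed S k) x \<partial>M)"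
      by (intro Bochner_Integration.integral_cong) (auto simp: indicator_def)
    also have "\<dots> = prob (D \<inter> disjointed S k)"
      by simp
    finally show ?thesis .
  qed
  have "(\<lambda>k. prob (disjointed S k)) sums prob (\<Union>k. disjointed S k)"
    by (rule finite_measure_UNION) (auto simp: disjoint_family_disjointed)
  then have 1: "(\<lambda>k. c * prob (disjointed S k)) sums (c * prob (\<Union>k. disjointed S k))"
    by (rule sums_mult)
  have "(\<lambda>k. prob (D \<inter> disjointed S k)) sums prob (\<Union>k. D \<inter> disjointed S k)"
    using disjoint_family_disjointed[of S]
    by (intro finite_measure_UNION) (auto simp: disjoint_family_on_def)
  from sums_le[OF le 1 this]
  have "c * prob (\<Union>k. disjointed S k) \<le> prob (\<Union>k. D \<inter> disjointed S k)" .
  also have "\<dots> \<le> prob D"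
    by (rule finite_measure_mono) auto
  also have "(\<Union>k. disjointed S k) = {x \<in> space M. \<exists>k. c < real_cond_exp M (F k) (indicator D) x}"
    by (auto simp: UN_disjointed_eq S_def Y_def)
  finally show ?thesis .
qed

text \<open>
  Replace \<open>A\<close> by a nearby \<open>B\<close> that is already known at some finite stage: from then on the error is
  at most the indicator of the symmetric difference \<open>D\<close> plus its conditional probability, and the
  maximal inequality controls the latter uniformly in time.
\<close>

theorem (in prob_space) Levy_zero_one:
  fixes F :: "nat \<Rightarrow> 'a measure"
  assumes F: "\<And>n. subalgebra M (F n)" "\<And>m n. m \<le> n \<Longrightarrow> sets (F m) \<subseteq> sets (F n)"
    and gen: "sets M = sigma_sets (space M) (\<Union>n. sets (F n))"
    and A[measurable]: "A \<in> sets M"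
  shows "AE x in M. (\<lambda>n. real_cond_exp M (F n) (indicator A) x) \<longlonglongrightarrow> indicator A x"
proof -
  define Y where "Y = (\<lambda>n. real_cond_exp M (F n) (indicator A))"
  have [measurable]: "Y n \<in> borel_measurable M" for n
    by (simp add: Y_def)
  have ev: "AE x in M. eventually (\<lambda>n. \<bar>Y n x - indicator A x\<bar> \<le> c) sequentially" if c: "0 < c" for c
  proof -
    let ?bad = "{x \<in> space M. \<not> eventually (\<lambda>n. \<bar>Y n x - indicator A x\<bar> \<le> c) sequentially}"
    have bad[measurable]: "?bad \<in> sets M"
      unfolding eventually_sequentially by measurable
    have "prob ?bad \<le> e" if e: "0 < e" for e
    proof -
      \<comment> \<open>Two contributions must add up to at most \<open>e\<close>: the mass of
        \<open>D\<close>, which is below \<open>e'\<close>, and the maximal inequality at level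
        \<open>c\<close>, which gives at most \<open>e' / c\<close>.\<close>
      define e' where "e' = e / (1 + 1 / c)"
      have e': "0 < e'" "e' + e' / c = e"
      proof -
        have "0 < 1 + 1 / c" using c by (simp add: add_pos_pos)
        then show "0 < e'" "e' + e' / c = e"
          using e c by (simp_all add: e'_def add_divide_distrib[symmetric] divide_simps)
            (simp_all add: algebra_simps)
      qed
      obtain n B where B: "B \<in> sets (F n)" "prob (sym_diff A B) < e'"
        using sigma_sets_approximation[OF F gen A e'(1)] by blast
      have [measurable]: "B \<in> sets M"
        using B(1) F(1) by (auto simp: subalgebra_def)
      define D where "D = sym_diff A B"
      have D[measurable]: "D \<in> sets M"
        by (simp add: D_def)
      have diff: "indicator A x - indicator B x \<le> (indicator D x :: real)"
        "indicator B x - indicator A x \<le> (indicator D x :: real)" for x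
        by (auto simp: D_def indicator_def)
      have int: "integrable M (indicator A :: 'a \<Rightarrow> real)"
        "integrable M (indicator B :: 'a \<Rightarrow> real)" "integrable M (indicator D :: 'a \<Rightarrow> real)"
        by (auto intro: integrable_indicator)
      define Z where "Z = (\<lambda>k. real_cond_exp M (F k) (indicator D))"
      have [measurable]: "Z k \<in> borel_measurable M" for k
        by (simp add: Z_def)
      \<comment> \<open>From stage \<open>n\<close> on, \<open>indicator B\<close> is its own
        conditional expectation, so the difference is the conditional expectation of
        \<open>indicator A x - indicator B x\<close>. Monotonicity is applied to this function and
        to its negative, both of which lie below \<open>indicator D x\<close>.\<close>
      have "AE x in M. \<forall>k\<in>{n..}. \<bar>Y k x - indicator B x\<bar> \<le> Z k x"
      proof (rule AE_ball_countable')
        fix k assume "k \<in> {n..}"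
        then have k: "n \<le> k" by simp
        interpret G: finite_measure_subalgebra M "F k"
          by unfold_locales (rule F(1))
        have "B \<in> sets (F k)"
          using B(1) F(2)[OF k] by blast
        then have "AE x in M. real_cond_exp M (F k) (indicator B) x = (indicator B x :: real)"
          by (intro G.real_cond_exp_F_meas) (auto intro: integrable_indicator)
        moreover have "AE x in M. real_cond_exp M (F k) (\<lambda>x. indicator A x - indicator B x) x =
            Y k x - real_cond_exp M (F k) (indicator B) x"
          unfolding Y_def by (rule G.real_cond_exp_diff) (auto intro: integrable_indicator)
        moreover have "AE x in M. real_cond_exp M (F k) (\<lambda>x. indicator B x - indicator A x) x =
            real_cond_exp M (F k) (indicator B) x - Y k x"
          unfolding Y_def by (rule G.real_cond_exp_diff) (auto intro: integrable_indicator)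
        moreover have "AE x in M. real_cond_exp M (F k) (\<lambda>x. indicator A x - indicator B x) x \<le> Z k x"
          unfolding Z_def using diff int by (intro G.real_cond_exp_mono) auto
        moreover have "AE x in M. real_cond_exp M (F k) (\<lambda>x. indicator B x - indicator A x) x \<le> Z k x"
          unfolding Z_def using diff int by (intro G.real_cond_exp_mono) auto
        ultimately show "AE x in M. \<bar>Y k x - indicator B x\<bar> \<le> Z k x"
          by eventually_elim auto
      qed auto
      then have "AE x in M. x \<in> ?bad \<longrightarrow> x \<in> D \<union> {x \<in> space M. \<exists>k. c < Z k x}"
      proof eventually_elim
        case (elim x)
        show ?case
        proof (rule impI, rule ccontr)
          assume x: "x \<in> ?bad" "x \<notin> D \<union> {x \<in> space M. \<exists>k. c < Z k x}"
          then have "Z k x \<le> c" for k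
            by (auto simp: not_less)
          moreover have "indicator A x = (indicator B x :: real)"
            using x(2) by (auto simp: D_def indicator_def)
          ultimately have "\<bar>Y k x - indicator A x\<bar> \<le> c" if "n \<le> k" for k
            using elim that by (metis atLeast_iff order_trans)
          then show False
            using x(1) by (auto simp: eventually_sequentially)
        qed
      qed
      then have "prob ?bad \<le> prob (D \<union> {x \<in> space M. \<exists>k. c < Z k x})"
        by (rule finite_measure_mono_AE) measurable
      also have "\<dots> \<le> prob D + prob {x \<in> space M. \<exists>k. c < Z k x}"
        by (rule measure_Un_le) measurable
      also have "prob {x \<in> space M. \<exists>k. c < Z k x} \<le> prob D / c"
        using maximal_inequality_cond_prob[where c=c, OF F D] c by (simp add: Z_def field_simps)
      also have "prob D + prob D / c \<le> e' + e' / c"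
        using B(2) c by (intro add_mono divide_right_mono) (auto simp: D_def)
      finally show ?thesis
        using e'(2) by simp
    qed
    then have "prob ?bad \<le> 0"
      by (rule field_le_epsilon[of _ 0, simplified])
    then have "prob ?bad = 0"
      using measure_nonneg[of M ?bad] by linarith
    then have "?bad \<in> null_sets M"
      by (auto simp: emeasure_eq_measure)
    then show ?thesis
      by (rule AE_I') auto
  qed
  have "AE x in M. \<forall>j. eventually (\<lambda>n. \<bar>Y n x - indicator A x\<bar> \<le> inverse (real (Suc j))) sequentially"
    unfolding AE_all_countable by (intro allI ev) simp
  then show ?thesis
  proof eventually_elim
    case (elim x)
    show ?case
    proof (rule tendstoI)
      fix r :: real assume "0 < r"
      then obtain j where "inverse (real (Suc j)) < r"
        using reals_Archimedean by blast
      with elim[rule_format, of j]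
      show "eventually (\<lambda>n. dist (real_cond_exp M (F n) (indicator A) x) (indicator A x) < r) sequentially"
        by (auto simp: Y_def dist_real_def elim!: eventually_mono)
    qed
  qed
qed

section \<open>Weak convergence tested on open sets\<close>

lemma openin_sets_borel_of: "openin T U \<Longrightarrow> U \<in> sets (borel_of T)"
  unfolding borel_of_def by (auto dest: openin_subset intro: in_measure_of)

lemma sets_borel_of: "sets (borel_of T) = sigma_sets (topspace T) {U. openin T U}"
  unfolding borel_of_def by (rule sets_measure_of) (auto dest: openin_subset)

lemma continuous_map_measurable:
  assumes "continuous_map T S f"
  shows "f \<in> borel_of T \<rightarrow>\<^sub>M borel_of S"
  unfolding borel_of_def[of S]
proof (rule measurable_measure_of)
  show "f \<in> space (borel_of T) \<rightarrow> topspace S"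
    using assms by (auto simp: continuous_map_def)
  show "f -` U \<inter> space (borel_of T) \<in> sets (borel_of T)" if "U \<in> {U. openin S U}" for U
  proof -
    have "openin T {x \<in> topspace T. f x \<in> U}"
      using assms that by (auto simp: continuous_map_def)
    moreover have "f -` U \<inter> space (borel_of T) = {x \<in> topspace T. f x \<in> U}"
      by auto
    ultimately show ?thesis
      by (simp add: openin_sets_borel_of)
  qed
qed (auto dest: openin_subset)

lemma continuous_map_borel_measurable:
  fixes f :: "'a \<Rightarrow> 'b::topological_space"
  assumes "continuous_map T euclidean f"
  shows "f \<in> borel_measurable (borel_of T)"
proof -
  have "sets (borel_of (euclidean :: 'b topology)) = sets borel"
    by (simp add: sets_borel_of borel_def)
  with continuous_map_measurable[OF assms] show ?thesis
    by (simp cong: measurable_cong_sets)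
qed

lemma prob_measuresD:
  assumes "\<mu> \<in> prob_measures T"
  shows "prob_space \<mu>" "sets \<mu> = sets (borel_of T)" "space \<mu> = topspace T"
  using assms sets_eq_imp_space_eq[of \<mu> "borel_of T"] by (auto simp: prob_measures_def)

lemma prob_measures_integrable:
  fixes f :: "'a \<Rightarrow> real"
  assumes \<mu>: "\<mu> \<in> prob_measures T" and f: "f \<in> borel_measurable (borel_of T)"
    and bound: "\<And>x. x \<in> topspace T \<Longrightarrow> \<bar>f x\<bar> \<le> b"
  shows "integrable \<mu> f"
proof -
  interpret prob_space \<mu> using prob_measuresD(1)[OF \<mu>] .
  have "f \<in> borel_measurable \<mu>"
    using f prob_measuresD(2)[OF \<mu>] by (simp cong: measurable_cong_sets)
  then show ?thesis
    using bound prob_measuresD(3)[OF \<mu>] by (intro integrable_const_bound[where B=b]) auto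
qed

text \<open>This is the form in which a class of test functions is shown to determine weak
  convergence. The sequence \<open>g\<close> may fail to increase in \<open>k\<close>: being bounded
  by 1, it is handled by dominated convergence.\<close>

definition lower_approximates :: "'a topology \<Rightarrow> ('a \<Rightarrow> real) set \<Rightarrow> bool" where
  "lower_approximates T \<A> \<longleftrightarrow> (\<forall>U. openin T U \<longrightarrow> (\<exists>g :: nat \<Rightarrow> 'a \<Rightarrow> real.
     (\<forall>k. g k \<in> \<A> \<and> (\<forall>x\<in>topspace T. 0 \<le> g k x \<and> g k x \<le> indicator U x)) \<and>
     (\<forall>x\<in>U. (\<lambda>k. g k x) \<longlonglongrightarrow> 1)))"

lemma lower_approximatesE:
  assumes "lower_approximates T \<A>" "openin T U"
  obtains g :: "nat \<Rightarrow> 'a \<Rightarrow> real" where "\<And>k. g k \<in> \<A>"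
    and "\<And>k x. x \<in> topspace T \<Longrightarrow> 0 \<le> g k x"
    and "\<And>k x. x \<in> topspace T \<Longrightarrow> g k x \<le> indicator U x"
    and "\<And>x. x \<in> topspace T \<Longrightarrow> (\<lambda>k. g k x) \<longlonglongrightarrow> indicator U x"
proof -
  obtain g :: "nat \<Rightarrow> 'a \<Rightarrow> real" where g: "\<And>k. g k \<in> \<A>"
    "\<And>k x. x \<in> topspace T \<Longrightarrow> 0 \<le> g k x \<and> g k x \<le> indicator U x"
    "\<And>x. x \<in> U \<Longrightarrow> (\<lambda>k. g k x) \<longlonglongrightarrow> 1"
    using assms unfolding lower_approximates_def by metis
  have "(\<lambda>k. g k x) \<longlonglongrightarrow> indicator U x" if "x \<in> topspace T" for x
  proof (cases "x \<in> U")
    case False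
    then have "g k x = 0" for k
      using g(2)[OF that, of k] by simp
    with False show ?thesis by simp
  qed (use g(3) in simp)
  with g that show thesis by blast
qed

lemma lower_approximates_integral_limit:
  assumes U: "openin T U" and g: "\<And>k. g k \<in> borel_measurable (borel_of T)"
    "\<And>k x. x \<in> topspace T \<Longrightarrow> 0 \<le> g k x"
    "\<And>k x. x \<in> topspace T \<Longrightarrow> g k x \<le> indicator U x"
    "\<And>x. x \<in> topspace T \<Longrightarrow> (\<lambda>k. g k x) \<longlonglongrightarrow> (indicator U x :: real)"
    and \<mu>: "\<mu> \<in> prob_measures T"
  shows "(\<lambda>k. \<integral>x. g k x \<partial>\<mu>) \<longlonglongrightarrow> measure \<mu> U" "\<And>k. (\<integral>x. g k x \<partial>\<mu>) \<le> measure \<mu> U"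
proof -
  interpret prob_space \<mu> using prob_measuresD(1)[OF \<mu>] .
  note [measurable_cong] = prob_measuresD(2)[OF \<mu>]
  have [measurable]: "U \<in> sets \<mu>"
    using openin_sets_borel_of[OF U] prob_measuresD(2)[OF \<mu>] by simp
  note [measurable] = g(1)
  have ind: "(\<integral>x. indicator U x \<partial>\<mu>) = measure \<mu> U"
    by simp
  have abs: "\<bar>g k x\<bar> \<le> 1" if "x \<in> topspace T" for k x
    using g(2)[OF that, of k] order_trans[OF g(3)[OF that, of k] indicator_le_1] by simp
  have "(\<lambda>k. \<integral>x. g k x \<partial>\<mu>) \<longlonglongrightarrow> (\<integral>x. indicator U x \<partial>\<mu>)"
  proof (rule integral_dominated_convergence[where w="\<lambda>_. 1"])
    show "AE x in \<mu>. norm (g k x) \<le> 1" for k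
      using abs prob_measuresD(3)[OF \<mu>] by (intro AE_I2) simp
  qed (use g(4) prob_measuresD(3)[OF \<mu>] in auto)
  then show "(\<lambda>k. \<integral>x. g k x \<partial>\<mu>) \<longlonglongrightarrow> measure \<mu> U"
    by (simp only: ind)
  fix k
  have "integrable \<mu> (g k)"
    using prob_measures_integrable[OF \<mu> g(1), of k 1] abs by blast
  moreover have "integrable \<mu> (indicator U :: _ \<Rightarrow> real)"
    by (rule integrable_real_indicator) (auto simp: less_top[symmetric])
  ultimately have "(\<integral>x. g k x \<partial>\<mu>) \<le> (\<integral>x. indicator U x \<partial>\<mu>)"
    using g(3) prob_measuresD(3)[OF \<mu>] by (intro integral_mono) auto
  then show "(\<integral>x. g k x \<partial>\<mu>) \<le> measure \<mu> U"
    by (simp only: ind)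
qed

text \<open>The sum counts the integers among \<open>1, ..., N\<close> that lie strictly below
  \<open>y\<close>. The strict inequality is what makes the corresponding level sets of a continuous
  function open.\<close>

lemma step_function_bounds:
  fixes y :: real
  assumes "0 \<le> y"
  shows "(\<Sum>i<N. indicator {y. real (Suc i) < y} y) \<le> y"
    and "y \<le> real N \<Longrightarrow> y \<le> (\<Sum>i<N. indicator {y. real (Suc i) < y} y) + 1"
proof -
  have le: "(\<Sum>i<n. indicator {y. real (Suc i) < y} y :: real) \<le> real n" for n
    using sum_bounded_above[of "{..<n}" "\<lambda>i. indicator {y. real (Suc i) < y} y :: real" 1] by simp
  show "(\<Sum>i<N. indicator {y. real (Suc i) < y} y) \<le> y"
  proof (induction N)
    case (Suc n)
    with le[of n] show ?case by (auto simp: indicator_def)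
  qed (use assms in simp)
  show "y \<le> (\<Sum>i<N. indicator {y. real (Suc i) < y} y) + 1" if "y \<le> real N"
    using that
  proof (induction N)
    case (Suc n)
    show ?case
    proof (cases "y \<le> real n")
      case True
      with Suc.IH show ?thesis by (auto intro: order_trans)
    next
      case False
      then have "(\<Sum>i<n. indicator {y. real (Suc i) < y} y :: real) = (\<Sum>i<n. 1)"
        by (intro sum.cong) auto
      with Suc.prems show ?thesis by simp
    qed
  qed simp
qed

text \<open>
  Layer cake: up to an error \<open>1/N\<close>, the integral of \<open>f\<close> is the mean of the masses of the open sets
  \<open>{f > i/N}\<close>.
\<close>

lemma portmanteau_unit_interval:
  fixes \<mu> :: "'i \<Rightarrow> 'a measure" and f :: "'a \<Rightarrow> real"
  assumes open_lim: "\<And>U e. openin T U \<Longrightarrow> 0 < e \<Longrightarrow>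
      eventually (\<lambda>i. measure \<nu> U - e < measure (\<mu> i) U) F"
    and \<nu>: "\<nu> \<in> prob_measures T" and ev: "eventually (\<lambda>i. \<mu> i \<in> prob_measures T) F"
    and f: "continuous_map T euclideanreal f" "\<And>x. x \<in> topspace T \<Longrightarrow> 0 \<le> f x \<and> f x \<le> 1"
    and e: "0 < e"
  shows "eventually (\<lambda>i. (\<integral>x. f x \<partial>\<nu>) - e < (\<integral>x. f x \<partial>\<mu> i)) F"
proof -
  \<comment> \<open>Half of \<open>e\<close> pays for the discretisation, the other half for the
    \<open>N\<close> masses of open sets, each of which enters with weight
    \<open>1 / N\<close>.\<close>
  obtain N :: nat where N: "0 < N" "1 / real N < e / 2"
    using e by (metis half_gt_zero nat_approx_posE of_nat_Suc zero_less_Suc inverse_eq_divide)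
  define V where "V i = {x \<in> topspace T. real (Suc i) < real N * f x}" for i
  have V: "openin T (V i)" for i
  proof -
    have "openin T {x \<in> topspace T. f x \<in> {real (Suc i) / real N<..}}"
      by (rule openin_continuous_map_preimage[OF f(1)]) (simp add: open_openin[symmetric])
    also have "{x \<in> topspace T. f x \<in> {real (Suc i) / real N<..}} = V i"
      using N by (auto simp: V_def field_simps)
    finally show ?thesis .
  qed
  have ind: "indicator {y. real (Suc i) < y} (real N * f x) = (indicator (V i) x :: real)"
    if "x \<in> topspace T" for i x
    using that by (auto simp: V_def indicator_def)
  have bounds: "(\<Sum>i<N. measure \<kappa> (V i)) \<le> real N * (\<integral>x. f x \<partial>\<kappa>)"
    "real N * (\<integral>x. f x \<partial>\<kappa>) \<le> (\<Sum>i<N. measure \<kappa> (V i)) + 1" if \<kappa>: "\<kappa> \<in> prob_measures T" for \<kappa>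
  proof -
    interpret prob_space \<kappa> using prob_measuresD(1)[OF \<kappa>] .
    have [measurable]: "V i \<in> sets \<kappa>" for i
      using openin_sets_borel_of[OF V] prob_measuresD(2)[OF \<kappa>] by simp
    have int: "integrable \<kappa> f"
      using f(2) by (intro prob_measures_integrable[OF \<kappa> continuous_map_borel_measurable[OF f(1)], of 1]) auto
    have intV: "integrable \<kappa> (indicator (V i) :: _ \<Rightarrow> real)" for i
      by (rule integrable_real_indicator) (auto simp: less_top[symmetric])
    have sum: "(\<integral>x. (\<Sum>i<N. indicator (V i) x) \<partial>\<kappa>) = (\<Sum>i<N. measure \<kappa> (V i))"
      using intV by (simp add: Bochner_Integration.integral_sum)
    have step: "(\<Sum>i<N. indicator (V i) x) \<le> real N * f x"
      "real N * f x \<le> (\<Sum>i<N. indicator (V i) x) + 1" if "x \<in> topspace T" for x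
      using step_function_bounds[of "real N * f x" N] f(2)[OF that]
      by (simp_all add: ind[OF that, symmetric] mult_left_le)
    have "(\<integral>x. (\<Sum>i<N. indicator (V i) x) \<partial>\<kappa>) \<le> (\<integral>x. real N * f x \<partial>\<kappa>)"
      using int intV step(1) prob_measuresD(3)[OF \<kappa>] by (intro integral_mono) auto
    then show "(\<Sum>i<N. measure \<kappa> (V i)) \<le> real N * (\<integral>x. f x \<partial>\<kappa>)"
      by (simp only: sum) simp
    have "(\<integral>x. real N * f x \<partial>\<kappa>) \<le> (\<integral>x. (\<Sum>i<N. indicator (V i) x) + 1 \<partial>\<kappa>)"
      using int intV step(2) prob_measuresD(3)[OF \<kappa>] by (intro integral_mono) auto
    also have "\<dots> = (\<integral>x. (\<Sum>i<N. indicator (V i) x) \<partial>\<kappa>) + 1"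
      using intV by (subst Bochner_Integration.integral_add) (auto simp: prob_space)
    finally show "real N * (\<integral>x. f x \<partial>\<kappa>) \<le> (\<Sum>i<N. measure \<kappa> (V i)) + 1"
      by (simp only: sum) simp
  qed
  have "eventually (\<lambda>i. \<forall>j\<in>{..<N}. measure \<nu> (V j) - e / 2 < measure (\<mu> i) (V j)) F"
    using e by (intro eventually_ball_finite ballI open_lim V) auto
  then show ?thesis
    using ev
  proof eventually_elim
    case (elim i)
    have "(\<Sum>j<N. measure \<nu> (V j)) - real N * (e / 2) = (\<Sum>j<N. measure \<nu> (V j) - e / 2)"
      by (simp add: sum_subtractf)
    also have "\<dots> \<le> (\<Sum>j<N. measure (\<mu> i) (V j))"
      using elim(1) by (intro sum_mono) (auto intro: less_imp_le)
    finally have "real N * (\<integral>x. f x \<partial>\<nu>) - 1 - real N * (e / 2) \<le> real N * (\<integral>x. f x \<partial>\<mu> i)"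
      using bounds(1)[OF elim(2)] bounds(2)[OF \<nu>] by linarith
    then have "(\<integral>x. f x \<partial>\<nu>) - 1 / real N - e / 2 \<le> (\<integral>x. f x \<partial>\<mu> i)"
      using N(1) by (simp add: field_simps)
    with N(2) show ?case by linarith
  qed
qed

text \<open>A one-sided hypothesis gives two-sided convergence because a lower bound for the
  integral of \<open>- f\<close> is an upper bound for that of \<open>f\<close>. Both functions are
  brought into the unit interval by the affine map \<open>(f x + b) / (2 * b)\<close>, which turns
  the tolerance \<open>e\<close> into \<open>e / (2 * b)\<close>.\<close>

lemma portmanteau_open:
  fixes \<mu> :: "'i \<Rightarrow> 'a measure"
  assumes open_lim: "\<And>U e. openin T U \<Longrightarrow> 0 < e \<Longrightarrow>
      eventually (\<lambda>i. measure \<nu> U - e < measure (\<mu> i) U) F"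
    and \<nu>: "\<nu> \<in> prob_measures T" and ev: "eventually (\<lambda>i. \<mu> i \<in> prob_measures T) F"
  shows "limitin (weak_topology T) \<mu> \<nu> F"
  unfolding limitin_weak_topology
proof (intro conjI allI impI \<nu> ev)
  have lower: "eventually (\<lambda>i. (\<integral>x. f x \<partial>\<nu>) - e < (\<integral>x. f x \<partial>\<mu> i)) F"
    if f: "continuous_map T euclideanreal f" "\<And>x. x \<in> topspace T \<Longrightarrow> \<bar>f x\<bar> \<le> b" and b: "0 < b" and e: "0 < e" for f e b
  proof -
    let ?f = "\<lambda>x. (f x + b) / (2 * b)"
    have integral: "(\<integral>x. ?f x \<partial>\<kappa>) = ((\<integral>x. f x \<partial>\<kappa>) + b) / (2 * b)" if \<kappa>: "\<kappa> \<in> prob_measures T" for \<kappa>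
    proof -
      interpret prob_space \<kappa> using prob_measuresD(1)[OF \<kappa>] .
      show ?thesis
        using prob_measures_integrable[OF \<kappa> continuous_map_borel_measurable[OF f(1)] f(2)]
        by (simp add: prob_space)
    qed
    have "continuous_map T euclideanreal ?f"
      using f(1) b by (intro continuous_intros) auto
    moreover have "0 \<le> ?f x \<and> ?f x \<le> 1" if "x \<in> topspace T" for x
      using f(2)[OF that] b by (auto simp: field_simps)
    ultimately have "eventually (\<lambda>i. (\<integral>x. ?f x \<partial>\<nu>) - e / (2 * b) < (\<integral>x. ?f x \<partial>\<mu> i)) F"
      using b e by (intro portmanteau_unit_interval[OF open_lim \<nu> ev]) auto
    then show ?thesis
      using ev
    proof eventually_elim
      case (elim i)
      then have "((\<integral>x. f x \<partial>\<nu>) + b) / (2 * b) - e / (2 * b) < ((\<integral>x. f x \<partial>\<mu> i) + b) / (2 * b)"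
        by (simp only: integral[OF \<nu>] integral[OF elim(2)])
      then have "((\<integral>x. f x \<partial>\<nu>) + b - e) / (2 * b) < ((\<integral>x. f x \<partial>\<mu> i) + b) / (2 * b)"
        by (simp add: diff_divide_distrib)
      then show ?case
        using b by (simp add: divide_less_cancel)
    qed
  qed
  fix f assume f: "continuous_map T euclideanreal f \<and> bounded (f ` topspace T)"
  then obtain b where b: "0 < b" "\<And>x. x \<in> topspace T \<Longrightarrow> \<bar>f x\<bar> \<le> b"
    by (auto simp: bounded_pos)
  show "((\<lambda>i. \<integral>x. f x \<partial>\<mu> i) \<longlongrightarrow> (\<integral>x. f x \<partial>\<nu>)) F"
  proof (rule tendstoI)
    fix e :: real assume e: "0 < e"
    have "eventually (\<lambda>i. (\<integral>x. f x \<partial>\<nu>) - e < (\<integral>x. f x \<partial>\<mu> i)) F"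
      using f b e by (intro lower[of f b]) auto
    moreover have "eventually (\<lambda>i. (\<integral>x. - f x \<partial>\<nu>) - e < (\<integral>x. - f x \<partial>\<mu> i)) F"
      using f b e by (intro lower[of "\<lambda>x. - f x" b]) (auto intro!: continuous_intros)
    ultimately show "eventually (\<lambda>i. dist (\<integral>x. f x \<partial>\<mu> i) (\<integral>x. f x \<partial>\<nu>) < e) F"
      by eventually_elim (auto simp: dist_real_def)
  qed
qed

text \<open>The order of limits matters: \<open>k\<close> is fixed first, so that \<open>g k\<close>
  captures the \<open>\<nu>\<close>-mass of \<open>U\<close> up to \<open>e\<close>, and only then
  does \<open>i\<close> move. Convergence at this single test function passes to \<open>U\<close>
  because \<open>g k\<close> lies below its indicator.\<close>

lemma portmanteau_lower_approximates:
  fixes \<mu> :: "'i \<Rightarrow> 'a measure"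
  assumes \<A>: "lower_approximates T \<A>" "\<A> \<subseteq> borel_measurable (borel_of T)"
    and lim: "\<And>g. g \<in> \<A> \<Longrightarrow> ((\<lambda>i. \<integral>x. g x \<partial>\<mu> i) \<longlongrightarrow> (\<integral>x. g x \<partial>\<nu>)) F"
    and \<nu>: "\<nu> \<in> prob_measures T" and ev: "eventually (\<lambda>i. \<mu> i \<in> prob_measures T) F"
  shows "limitin (weak_topology T) \<mu> \<nu> F"
proof (rule portmanteau_open[OF _ \<nu> ev])
  fix U and e :: real assume U: "openin T U" and e: "0 < e"
  obtain g :: "nat \<Rightarrow> 'a \<Rightarrow> real" where g: "\<And>k. g k \<in> \<A>"
    "\<And>k x. x \<in> topspace T \<Longrightarrow> 0 \<le> g k x"
    "\<And>k x. x \<in> topspace T \<Longrightarrow> g k x \<le> indicator U x"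
    "\<And>x. x \<in> topspace T \<Longrightarrow> (\<lambda>k. g k x) \<longlonglongrightarrow> indicator U x"
    by (rule lower_approximatesE[OF \<A>(1) U]) blast
  have meas: "g k \<in> borel_measurable (borel_of T)" for k
    using g(1) \<A>(2) by blast
  have gU: "(\<lambda>k. \<integral>x. g k x \<partial>\<kappa>) \<longlonglongrightarrow> measure \<kappa> U" "\<And>k. (\<integral>x. g k x \<partial>\<kappa>) \<le> measure \<kappa> U"
    if "\<kappa> \<in> prob_measures T" for \<kappa>
    by (rule lower_approximates_integral_limit[OF U meas _ _ _ that]; use g in blast)+
  have "eventually (\<lambda>k. measure \<nu> U - e < (\<integral>x. g k x \<partial>\<nu>)) sequentially"
    using e by (intro order_tendstoD(1)[OF gU(1)[OF \<nu>]]) auto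
  then obtain k where "measure \<nu> U - e < (\<integral>x. g k x \<partial>\<nu>)"
    by (auto simp: eventually_sequentially)
  then have "eventually (\<lambda>i. measure \<nu> U - e < (\<integral>x. g k x \<partial>\<mu> i)) F"
    by (intro order_tendstoD(1)[OF lim[OF g(1)]])
  then show "eventually (\<lambda>i. measure \<nu> U - e < measure (\<mu> i) U) F"
    using ev
  proof eventually_elim
    case (elim i)
    then show ?case using gU(2)[OF elim(2), of k] by simp
  qed
qed

text \<open>In a metrizable space an open set is an increasing union of closed sets
  \<open>C n\<close>. Urysohn functions that are 1 on \<open>C n\<close> and 0 off \<open>U\<close>
  do the job, since each point of \<open>U\<close> lies in all \<open>C n\<close> from some index
  on.\<close>

lemma metrizable_lower_approximates:
  assumes "metrizable_space T"
  shows "lower_approximates T {f. continuous_map T euclideanreal f \<and> bounded (f ` topspace T)}"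
  unfolding lower_approximates_def
proof (intro allI impI)
  fix U assume U: "openin T U"
  obtain C where C: "\<And>n. closedin T (C n)" "\<And>n. C n \<subseteq> C (Suc n)" "\<Union> (range C) = U"
    using open_imp_fsigma_in[OF assms U] unfolding fsigma_in_ascending by blast
  have "\<exists>f. continuous_map T (top_of_set {0..1::real}) f \<and> f ` (topspace T - U) \<subseteq> {0} \<and> f ` C n \<subseteq> {1}" for n
  proof -
    have "disjnt (topspace T - U) (C n)"
      using C(3) by (auto simp: disjnt_def)
    then show ?thesis
      using Urysohn_lemma[of T "topspace T - U" "C n" 0 1] metrizable_imp_normal_space[OF assms] C(1) U
      by (metis closedin_diff closedin_topspace zero_le_one)
  qed
  then obtain g :: "nat \<Rightarrow> 'a \<Rightarrow> real" where
    g: "\<And>n. continuous_map T (top_of_set {0..1}) (g n)" "\<And>n. g n ` (topspace T - U) \<subseteq> {0}"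
      "\<And>n. g n ` C n \<subseteq> {1}"
    by metis
  have unit: "g n x \<in> {0..1}" if "x \<in> topspace T" for n x
    using g(1)[of n] that by (auto simp: continuous_map_in_subtopology)
  have "continuous_map T euclideanreal (g n)" for n
    using g(1)[of n] by (simp add: continuous_map_in_subtopology)
  moreover have "bounded (g n ` topspace T)" for n
    by (rule bounded_subset[of "{0..1}"]) (use unit in auto)
  moreover have "0 \<le> g n x \<and> g n x \<le> indicator U x" if "x \<in> topspace T" for n x
    using unit[OF that, of n] g(2)[of n] that by (auto simp: indicator_def)
  moreover have "(\<lambda>n. g n x) \<longlonglongrightarrow> 1" if "x \<in> U" for x
  proof -
    obtain m where "x \<in> C m"
      using C(3) \<open>x \<in> U\<close> by blast
    then have "x \<in> C n" if "m \<le> n" for n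
      using lift_Suc_mono_le[of C, OF C(2) that] by blast
    then have "g n x = 1" if "m \<le> n" for n
      using g(3)[of n] that by blast
    then have "eventually (\<lambda>n. g n x = 1) sequentially"
      by (auto simp: eventually_sequentially)
    then show ?thesis
      by (rule tendsto_eventually)
  qed
  ultimately show "\<exists>g :: nat \<Rightarrow> 'a \<Rightarrow> real.
      (\<forall>k. g k \<in> {f. continuous_map T euclideanreal f \<and> bounded (f ` topspace T)} \<and>
        (\<forall>x\<in>topspace T. 0 \<le> g k x \<and> g k x \<le> indicator U x)) \<and>
      (\<forall>x\<in>U. (\<lambda>k. g k x) \<longlonglongrightarrow> 1)"
    by blast
qed

text \<open>If \<open>\<psi> j k x\<close> is read as a probability,
  \<open>1 - (\<Prod>j\<in>J. 1 - \<psi> j k x)\<close> is the probability that at least one of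
  independent events occurs. It stays in the unit interval, vanishes where all bumps vanish, and
  dominates each single bump. A maximum would share these properties, but a polynomial in the bumps
  can be expanded and integrated over a product space.\<close>

lemma lower_approximates_base:
  fixes \<psi> :: "'j \<Rightarrow> nat \<Rightarrow> 'a \<Rightarrow> real"
  assumes K: "countable K"
    and base: "\<And>U x. openin T U \<Longrightarrow> x \<in> U \<Longrightarrow> \<exists>j\<in>K. x \<in> B j \<and> B j \<subseteq> U"
    and \<psi>: "\<And>j k x. j \<in> K \<Longrightarrow> x \<in> topspace T \<Longrightarrow> 0 \<le> \<psi> j k x"
      "\<And>j k x. j \<in> K \<Longrightarrow> x \<in> topspace T \<Longrightarrow> \<psi> j k x \<le> indicator (B j) x"
      "\<And>j x. j \<in> K \<Longrightarrow> x \<in> topspace T \<Longrightarrow> x \<in> B j \<Longrightarrow> (\<lambda>k. \<psi> j k x) \<longlonglongrightarrow> 1"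
  shows "lower_approximates T {\<lambda>x. 1 - (\<Prod>j\<in>J. 1 - \<psi> j k x) | J k. finite J \<and> J \<subseteq> K}"
  unfolding lower_approximates_def
proof (intro allI impI)
  fix U assume U: "openin T U"
  define KU where "KU = {j \<in> K. B j \<subseteq> U}"
  have KU: "countable KU"
    using K by (simp add: KU_def)
  define J where "J n = {j \<in> KU. to_nat_on KU j < n}" for n
  have J: "finite (J n)" "J n \<subseteq> KU" for n
  proof -
    have "inj_on (to_nat_on KU) (J n)"
      using inj_on_to_nat_on[OF KU] by (rule inj_on_subset) (auto simp: J_def)
    moreover have "finite (to_nat_on KU ` J n)"
      by (rule finite_subset[of _ "{..<n}"]) (auto simp: J_def)
    ultimately show "finite (J n)"
      by (rule finite_imageD[rotated])
  qed (auto simp: J_def)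
  define g where "g n x = 1 - (\<Prod>j\<in>J n. 1 - \<psi> j n x)" for n x
  have factor: "0 \<le> 1 - \<psi> j n x" "1 - \<psi> j n x \<le> 1" if "j \<in> KU" "x \<in> topspace T" for j n x
    using \<psi>(1,2)[of j x n] order_trans[OF \<psi>(2) indicator_le_1, of j x n] that by (auto simp: KU_def)
  have prod: "0 \<le> (\<Prod>j\<in>L. 1 - \<psi> j n x)" "(\<Prod>j\<in>L. 1 - \<psi> j n x) \<le> 1"
    if "L \<subseteq> KU" "x \<in> topspace T" for L n x
    by (intro prod_nonneg prod_le_1 conjI factor subsetD[OF that(1)] that(2); assumption)+
  have "0 \<le> g n x \<and> g n x \<le> indicator U x" if x: "x \<in> topspace T" for n x
  proof (cases "x \<in> U")
    case True
    then show ?thesis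
      using prod[OF J(2) x, of n n] by (simp add: g_def)
  next
    case False
    have "\<psi> j n x = 0" if "j \<in> J n" for j
    proof -
      have j: "j \<in> K" "x \<notin> B j"
        using that J(2)[of n] False by (auto simp: KU_def)
      then show ?thesis
        using \<psi>(1)[OF j(1) x, of n] \<psi>(2)[OF j(1) x, of n] by simp
    qed
    then have "g n x = 0"
      by (simp add: g_def)
    then show ?thesis by simp
  qed
  moreover have "(\<lambda>n. g n x) \<longlonglongrightarrow> 1" if x: "x \<in> U" for x
  proof -
    have xT: "x \<in> topspace T"
      using openin_subset[OF U] x by blast
    obtain j where j: "j \<in> K" "x \<in> B j" "B j \<subseteq> U"
      using base[OF U x] by blast
    then have jKU: "j \<in> KU" by (simp add: KU_def)
    have "eventually (\<lambda>n. \<psi> j n x \<le> g n x) sequentially"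
      using eventually_gt_at_top[of "to_nat_on KU j"]
    proof eventually_elim
      case (elim n)
      then have "j \<in> J n"
        using jKU by (simp add: J_def)
      \<comment> \<open>All the other factors are at most 1, so one bump around \<open>x\<close>
        already bounds \<open>g n x\<close> from below.\<close>
      then have "(\<Prod>j\<in>J n. 1 - \<psi> j n x) = (1 - \<psi> j n x) * (\<Prod>j\<in>J n - {j}. 1 - \<psi> j n x)"
        by (rule prod.remove[OF J(1)])
      also have "\<dots> \<le> (1 - \<psi> j n x) * 1"
        using factor[OF jKU xT] prod(2)[of "J n - {j}" x n] J(2)[of n] xT
        by (intro mult_left_mono) auto
      finally show ?case by (simp add: g_def)
    qed
    moreover have "eventually (\<lambda>n. g n x \<le> 1) sequentially"
      using prod(1)[OF J(2) xT] by (simp add: g_def)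
    ultimately show ?thesis
      using \<psi>(3)[OF j(1) xT j(2)] tendsto_const by (rule tendsto_sandwich)
  qed
  moreover have "g n \<in> {\<lambda>x. 1 - (\<Prod>j\<in>J. 1 - \<psi> j k x) | J k. finite J \<and> J \<subseteq> K}" for n
    unfolding g_def using J[of n] by (intro CollectI exI[of _ "J n"] exI[of _ n]) (auto simp: KU_def)
  ultimately show "\<exists>g :: nat \<Rightarrow> 'a \<Rightarrow> real.
      (\<forall>k. g k \<in> {\<lambda>x. 1 - (\<Prod>j\<in>J. 1 - \<psi> j k x) | J k. finite J \<and> J \<subseteq> K} \<and>
        (\<forall>x\<in>topspace T. 0 \<le> g k x \<and> g k x \<le> indicator U x)) \<and>
      (\<forall>x\<in>U. (\<lambda>k. g k x) \<longlonglongrightarrow> 1)"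
    by blast
qed

section \<open>Second countability of the space of laws\<close>

lemma continuous_map_integral:
  assumes "continuous_map T euclideanreal f" "bounded (f ` topspace T)"
  shows "continuous_map (weak_topology T) euclideanreal (\<lambda>\<mu>. \<integral>x. f x \<partial>\<mu>)"
  unfolding continuous_map_atin
proof
  fix \<mu> assume "\<mu> \<in> topspace (weak_topology T)"
  then have "limitin (weak_topology T) (\<lambda>\<mu>. \<mu>) \<mu> (atin (weak_topology T) \<mu>)"
    using limitin_continuous_map[OF continuous_map_id, of \<mu> "weak_topology T" \<mu>] by (simp add: id_def)
  then show "limitin euclideanreal (\<lambda>\<mu>. \<integral>x. f x \<partial>\<mu>) (\<integral>x. f x \<partial>\<mu>) (atin (weak_topology T) \<mu>)"
    using assms by (simp add: limitin_weak_topology)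
qed

lemma lower_approximates_choice:
  assumes "lower_approximates T \<A>"
  obtains \<psi> :: "'a set \<Rightarrow> nat \<Rightarrow> 'a \<Rightarrow> real" where "\<And>U k. openin T U \<Longrightarrow> \<psi> U k \<in> \<A>"
    and "\<And>U k x. openin T U \<Longrightarrow> x \<in> topspace T \<Longrightarrow> 0 \<le> \<psi> U k x"
    and "\<And>U k x. openin T U \<Longrightarrow> x \<in> topspace T \<Longrightarrow> \<psi> U k x \<le> indicator U x"
    and "\<And>U x. openin T U \<Longrightarrow> x \<in> topspace T \<Longrightarrow> (\<lambda>k. \<psi> U k x) \<longlonglongrightarrow> indicator U x"
proof -
  define P where "P U g \<longleftrightarrow> (\<forall>k :: nat. g k \<in> \<A>) \<and> (\<forall>k. \<forall>x\<in>topspace T. 0 \<le> g k x) \<and>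
    (\<forall>k. \<forall>x\<in>topspace T. g k x \<le> indicator U x) \<and>
    (\<forall>x\<in>topspace T. (\<lambda>k. g k x) \<longlonglongrightarrow> indicator U x)" for U and g :: "nat \<Rightarrow> 'a \<Rightarrow> real"
  have "\<exists>g. P U g" if "U \<in> {U. openin T U}" for U
  proof -
    have U: "openin T U" using that by simp
    show ?thesis
    proof (rule lower_approximatesE[OF assms U])
      fix g :: "nat \<Rightarrow> 'a \<Rightarrow> real"
      assume "\<And>k. g k \<in> \<A>" "\<And>k x. x \<in> topspace T \<Longrightarrow> 0 \<le> g k x"
        "\<And>k x. x \<in> topspace T \<Longrightarrow> g k x \<le> indicator U x"
        "\<And>x. x \<in> topspace T \<Longrightarrow> (\<lambda>k. g k x) \<longlonglongrightarrow> indicator U x"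
      then have "P U g" by (simp add: P_def)
      then show ?thesis by blast
    qed
  qed
  then have "\<exists>\<psi>. \<forall>U\<in>{U. openin T U}. P U (\<psi> U)"
    by (intro bchoice ballI)
  then obtain \<psi> where \<psi>: "\<And>U. openin T U \<Longrightarrow> P U (\<psi> U)"
    by auto
  show thesis
    by (rule that[of \<psi>]) (use \<psi> in \<open>auto simp: P_def\<close>)
qed

lemma second_countableE:
  assumes "second_countable T"
  obtains \<B> where "countable \<B>" "\<And>V. V \<in> \<B> \<Longrightarrow> openin T V"
    "\<And>U x. openin T U \<Longrightarrow> x \<in> U \<Longrightarrow> \<exists>V\<in>\<B>. x \<in> V \<and> V \<subseteq> U"
  using assms unfolding second_countable_def by (elim exE conjE) (simp only: Ball_def)

text \<open>
  The integrals of a countable family that approximates the indicators of open sets from below embed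
  the space of laws into the space of real sequences.
\<close>

lemma second_countable_weak_topology:
  fixes T :: "'a topology"
  assumes T: "metrizable_space T" "second_countable T"
  shows "second_countable (weak_topology T)"
proof -
  obtain \<B> where \<B>: "countable \<B>" "\<And>V. V \<in> \<B> \<Longrightarrow> openin T V"
    "\<And>U x. openin T U \<Longrightarrow> x \<in> U \<Longrightarrow> \<exists>V\<in>\<B>. x \<in> V \<and> V \<subseteq> U"
    by (rule second_countableE[OF T(2)]) blast
  obtain \<psi> where \<psi>: "\<And>V k. openin T V \<Longrightarrow> \<psi> V k \<in> {f. continuous_map T euclideanreal f \<and> bounded (f ` topspace T)}"
    "\<And>V k x. openin T V \<Longrightarrow> x \<in> topspace T \<Longrightarrow> 0 \<le> \<psi> V k x"
    "\<And>V k x. openin T V \<Longrightarrow> x \<in> topspace T \<Longrightarrow> \<psi> V k x \<le> indicator V x"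
    "\<And>V x. openin T V \<Longrightarrow> x \<in> topspace T \<Longrightarrow> (\<lambda>k. \<psi> V k x) \<longlonglongrightarrow> indicator V x"
    by (rule lower_approximates_choice[OF metrizable_lower_approximates[OF T(1)]]) blast
  define \<A> where "\<A> = {\<lambda>x. 1 - (\<Prod>V\<in>J. 1 - \<psi> V k x) | J k. finite J \<and> J \<subseteq> \<B>}"
  have \<A>: "lower_approximates T \<A>"
    unfolding \<A>_def
  proof (rule lower_approximates_base[where B="\<lambda>V. V", OF \<B>(1,3)])
    show "(\<lambda>k. \<psi> V k x) \<longlonglongrightarrow> 1" if "V \<in> \<B>" "x \<in> topspace T" "x \<in> V" for V x
      using \<psi>(4)[OF \<B>(2)[OF that(1)] that(2)] that(3) by simp
  qed (use \<psi>(2,3) \<B>(2) in blast)+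
  have \<A>_bounds: "continuous_map T euclideanreal g \<and> bounded (g ` topspace T)" if gA: "g \<in> \<A>" for g
  proof -
    obtain J k where J: "finite J" "J \<subseteq> \<B>" and g: "g = (\<lambda>x. 1 - (\<Prod>V\<in>J. 1 - \<psi> V k x))"
      using gA unfolding \<A>_def by blast
    have "continuous_map T euclideanreal g"
      unfolding g using J \<psi>(1) \<B>(2) by (intro continuous_map_diff continuous_map_prod) auto
    moreover have "\<bar>g x\<bar> \<le> 1" if "x \<in> topspace T" for x
    proof -
      have "0 \<le> \<psi> V k x \<and> \<psi> V k x \<le> 1" if "V \<in> J" for V
      proof -
        have V: "openin T V"
          using J(2) \<B>(2) that by blast
        show ?thesis
          using \<psi>(2)[OF V \<open>x \<in> topspace T\<close>] order_trans[OF \<psi>(3)[OF V \<open>x \<in> topspace T\<close>] indicator_le_1]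
          by simp
      qed
      then have "0 \<le> (\<Prod>V\<in>J. 1 - \<psi> V k x)" "(\<Prod>V\<in>J. 1 - \<psi> V k x) \<le> 1"
        by (simp_all add: prod_nonneg prod_le_1)
      then show ?thesis by (simp add: g)
    qed
    then have "bounded (g ` topspace T)"
      by (auto simp: bounded_iff)
    ultimately show ?thesis by simp
  qed
  have "countable \<A>"
  proof -
    let ?h = "\<lambda>(J, k) x. 1 - (\<Prod>V\<in>J. 1 - \<psi> V k x)"
    have "\<A> \<subseteq> ?h ` ({J. finite J \<and> J \<subseteq> \<B>} \<times> UNIV)"
    proof
      fix g assume "g \<in> \<A>"
      then obtain J k where "finite J" "J \<subseteq> \<B>" "g = (\<lambda>x. 1 - (\<Prod>V\<in>J. 1 - \<psi> V k x))"
        unfolding \<A>_def by blast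
      then show "g \<in> ?h ` ({J. finite J \<and> J \<subseteq> \<B>} \<times> UNIV)"
        by (intro image_eqI[of _ _ "(J, k)"]) simp_all
    qed
    then show ?thesis
      using countable_Collect_finite_subset[OF \<B>(1)] by (elim countable_subset) simp
  qed
  moreover have "\<A> \<noteq> {}"
    by (auto simp: \<A>_def intro!: exI[of _ "{}"])
  ultimately obtain a where a: "\<A> = range (a :: nat \<Rightarrow> 'a \<Rightarrow> real)"
    using uncountable_def by blast
  define E where "E \<mu> n = (\<integral>x. a n x \<partial>\<mu>)" for \<mu> and n :: nat
  have "continuous_map (weak_topology T) (product_topology (\<lambda>_. euclideanreal) UNIV) E"
    using \<A>_bounds a unfolding E_def
    by (intro continuous_map_coordinatewise_then_product continuous_map_integral) auto
  then have E: "continuous_map (weak_topology T) euclidean E"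
    by (simp only: euclidean_product_topology)
  obtain \<O> :: "(nat \<Rightarrow> real) set set" where \<O>: "countable \<O>" "topological_basis \<O>"
    using ex_countable_basis by blast
  let ?N = "\<lambda>G. {\<mu> \<in> topspace (weak_topology T). E \<mu> \<in> G}"
  have base: "\<exists>G\<in>\<O>. \<mu> \<in> ?N G \<and> ?N G \<subseteq> U" if U: "openin (weak_topology T) U" and \<mu>: "\<mu> \<in> U" for U \<mu>
  proof -
    have PM: "\<mu> \<in> prob_measures T"
      using openin_subset[OF U] \<mu> by auto
    \<comment> \<open>Along this filter of laws \<open>\<nu>\<close> with \<open>E \<nu>\<close>
      near \<open>E \<mu>\<close>, all integrals over \<open>\<A>\<close> converge, so the identity
      converges weakly to \<open>\<mu>\<close>. Hence every weak neighbourhood of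
      \<open>\<mu>\<close> contains the preimage of a neighbourhood of \<open>E \<mu>\<close>. A
      filter replaces sequences, which cannot be relied on before countability is known.\<close>
    define F where "F = inf (filtercomap E (nhds (E \<mu>))) (principal (prob_measures T))"
    have "(E \<longlongrightarrow> E \<mu>) F"
      unfolding F_def by (rule filterlim_mono[OF filterlim_filtercomap order_refl inf_le1])
    then have "((\<lambda>\<nu>. E \<nu> n) \<longlongrightarrow> E \<mu> n) F" for n
      by (rule isCont_tendsto_compose[rotated])
        (rule continuous_on_interior[OF continuous_on_product_coordinates], simp)
    then have "((\<lambda>\<nu>. \<integral>x. g x \<partial>\<nu>) \<longlongrightarrow> (\<integral>x. g x \<partial>\<mu>)) F" if "g \<in> \<A>" for g
      using that unfolding a E_def by auto
    moreover have "eventually (\<lambda>\<nu>. \<nu> \<in> prob_measures T) F"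
      by (simp add: F_def eventually_inf_principal)
    ultimately have "limitin (weak_topology T) (\<lambda>\<nu>. \<nu>) \<mu> F"
      using \<A>_bounds continuous_map_borel_measurable PM
      by (intro portmanteau_lower_approximates[OF \<A>]) auto
    then have "eventually (\<lambda>\<nu>. \<nu> \<in> U) F"
      using U \<mu> by (auto simp: limitin_def)
    then obtain V where V: "open V" "E \<mu> \<in> V" "\<And>\<nu>. E \<nu> \<in> V \<Longrightarrow> \<nu> \<in> prob_measures T \<Longrightarrow> \<nu> \<in> U"
      by (auto simp: F_def eventually_inf_principal eventually_filtercomap_nhds)
    obtain G where "G \<in> \<O>" "E \<mu> \<in> G" "G \<subseteq> V"
      using topological_basisE[OF \<O>(2) V(1,2)] by blast
    then show ?thesis
      using V(3) PM by (intro bexI[of _ G]) auto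
  qed
  have "openin (weak_topology T) (?N G)" if "G \<in> \<O>" for G
    using topological_basis_open[OF \<O>(2) that] by (intro openin_continuous_map_preimage[OF E]) (simp add: open_openin[symmetric])
  then show ?thesis
    unfolding second_countable_def using \<O>(1)
  proof (intro exI[of _ "?N ` \<O>"] conjI allI impI)
    fix U \<mu> assume "openin (weak_topology T) U \<and> \<mu> \<in> U"
    then obtain G where "G \<in> \<O>" "\<mu> \<in> ?N G" "?N G \<subseteq> U"
      using base[of U \<mu>] by blast
    then show "\<exists>V\<in>?N ` \<O>. \<mu> \<in> V \<and> V \<subseteq> U"
      by (intro bexI[of _ "?N G"] imageI conjI)
  qed simp_all
qed

section \<open>Powers of weakly convergent laws\<close>

definition cylinder_box :: "'a topology \<Rightarrow> 'i set \<Rightarrow> 'i set \<Rightarrow> ('i \<Rightarrow> 'a set) \<Rightarrow> ('i \<Rightarrow> 'a) set" where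
  "cylinder_box T I F V = {x \<in> topspace (product_topology (\<lambda>_. T) I). \<forall>i\<in>F. x i \<in> V i}"

text \<open>Coordinates whose side is all of \<open>topspace T\<close> are dropped rather than
  filled from \<open>\<B>\<close>, which need not contain the whole space. Restricting the sides to
  \<open>F\<close> makes them extensional, so the index pairs \<open>(F, V)\<close> form a countable
  set when \<open>I\<close> and \<open>\<B>\<close> are countable.\<close>

lemma product_topology_cylinder_base:
  assumes \<B>: "\<And>U x. openin T U \<Longrightarrow> x \<in> U \<Longrightarrow> \<exists>V\<in>\<B>. x \<in> V \<and> V \<subseteq> U"
    and U: "openin (product_topology (\<lambda>_. T) I) U" and x: "x \<in> U"
  obtains F V where "finite F" "F \<subseteq> I" "V \<in> F \<rightarrow>\<^sub>E \<B>"
    "x \<in> cylinder_box T I F V" "cylinder_box T I F V \<subseteq> U"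
proof -
  obtain W where W: "finite {i \<in> I. W i \<noteq> topspace T}" "\<And>i. i \<in> I \<Longrightarrow> openin T (W i)"
    "x \<in> Pi\<^sub>E I W" "Pi\<^sub>E I W \<subseteq> U"
    using U x unfolding openin_product_topology_alt by meson
  define F where "F = {i \<in> I. W i \<noteq> topspace T}"
  have F: "finite F" "F \<subseteq> I"
    using W(1) by (auto simp: F_def)
  have "\<exists>V\<in>\<B>. x i \<in> V \<and> V \<subseteq> W i" if "i \<in> F" for i
    using \<B>[OF W(2)] W(3) F(2) that by (auto simp: PiE_iff)
  then have "\<exists>V. \<forall>i\<in>F. V i \<in> \<B> \<and> x i \<in> V i \<and> V i \<subseteq> W i"
    by (intro bchoice) blast
  then obtain V where V: "\<And>i. i \<in> F \<Longrightarrow> V i \<in> \<B> \<and> x i \<in> V i \<and> V i \<subseteq> W i"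
    by blast
  have "x \<in> topspace (product_topology (\<lambda>_. T) I)"
    using openin_subset[OF U] x by blast
  then have 1: "x \<in> cylinder_box T I F (restrict V F)"
    using V by (simp add: cylinder_box_def)
  have "cylinder_box T I F (restrict V F) \<subseteq> Pi\<^sub>E I W"
  proof
    fix y assume y: "y \<in> cylinder_box T I F (restrict V F)"
    then have yT: "y \<in> I \<rightarrow>\<^sub>E topspace T"
      by (simp add: cylinder_box_def)
    have "y i \<in> W i" if "i \<in> I" for i
    proof (cases "i \<in> F")
      case True
      with y V[OF True] show ?thesis by (auto simp: cylinder_box_def)
    next
      case False
      with yT that show ?thesis by (auto simp: F_def PiE_iff)
    qed
    with yT show "y \<in> Pi\<^sub>E I W"
      by (simp add: PiE_iff)
  qed
  with W(4) have "cylinder_box T I F (restrict V F) \<subseteq> U" by simp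
  moreover have "restrict V F \<in> F \<rightarrow>\<^sub>E \<B>" using V by simp
  ultimately show thesis using that 1 F by blast
qed

lemma countable_cylinder_index:
  assumes "countable I" "countable \<B>"
  shows "countable (SIGMA F:{F. finite F \<and> F \<subseteq> I}. F \<rightarrow>\<^sub>E \<B>)"
  using assms by (intro countable_SIGMA countable_Collect_finite_subset countable_PiE) auto

text \<open>The product sigma-algebra is contained in the Borel one because projections are
  continuous. The converse is where countability enters: an open set is a union of boxes, and the
  base provides only countably many of them.\<close>

lemma sets_borel_of_product_topology:
  assumes T: "second_countable T" and I: "countable I"
  shows "sets (borel_of (product_topology (\<lambda>_. T) I)) = sets (PiM I (\<lambda>_. borel_of T))"
    (is "sets (borel_of ?S) = sets ?P")
proof (intro equalityI subsetI)
  obtain \<B> where \<B>: "countable \<B>" "\<And>V. V \<in> \<B> \<Longrightarrow> openin T V"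
    "\<And>U x. openin T U \<Longrightarrow> x \<in> U \<Longrightarrow> \<exists>V\<in>\<B>. x \<in> V \<and> V \<subseteq> U"
    by (rule second_countableE[OF T]) blast
  define K where "K = (SIGMA F:{F. finite F \<and> F \<subseteq> I}. F \<rightarrow>\<^sub>E \<B>)"
  define box where "box = (\<lambda>(F, V). cylinder_box T I F V)"
  have K: "countable K"
    unfolding K_def using I \<B>(1) by (rule countable_cylinder_index)
  have space: "topspace ?S = space ?P"
    by (simp add: space_PiM)
  have box: "box j \<in> sets ?P" if "j \<in> K" for j
  proof -
    obtain F V where j: "j = (F, V)" "finite F" "F \<subseteq> I" "V \<in> F \<rightarrow>\<^sub>E \<B>"
      using \<open>j \<in> K\<close> by (auto simp: K_def)
    have "{x \<in> space ?P. x i \<in> V i} \<in> sets ?P" if "i \<in> F" for i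
    proof -
      have "V i \<in> \<B>"
        using j(4) that by (rule PiE_mem)
      then have [measurable]: "V i \<in> sets (borel_of T)"
        by (rule openin_sets_borel_of[OF \<B>(2)])
      have [measurable]: "i \<in> I"
        using j(3) that by blast
      show ?thesis by measurable
    qed
    then have "{x \<in> space ?P. \<forall>i\<in>F. x i \<in> V i} \<in> sets ?P"
      using j(2) by (intro sets.sets_Collect_finite_All) auto
    then show ?thesis
      by (simp add: box_def j(1) cylinder_box_def space_PiM)
  qed
  have open_P: "U \<in> sets ?P" if U: "openin ?S U" for U
  proof -
    have "U = (\<Union>j\<in>{j\<in>K. box j \<subseteq> U}. box j)"
    proof (intro equalityI subsetI)
      fix x assume x: "x \<in> U"
      obtain F V where "finite F" "F \<subseteq> I" "V \<in> F \<rightarrow>\<^sub>E \<B>"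
        "x \<in> cylinder_box T I F V" "cylinder_box T I F V \<subseteq> U"
        by (rule product_topology_cylinder_base[OF _ U x, of \<B>, OF \<B>(3)])
      then show "x \<in> (\<Union>j\<in>{j\<in>K. box j \<subseteq> U}. box j)"
        by (intro UN_I[of "(F, V)"]) (simp_all add: K_def box_def)
    qed auto
    also have "\<dots> \<in> sets ?P"
      using K box by (intro sets.countable_UN') auto
    finally show ?thesis .
  qed
  fix A assume "A \<in> sets (borel_of ?S)"
  then have "A \<in> sigma_sets (space ?P) {U. openin ?S U}"
    by (simp only: sets_borel_of space)
  moreover have "sigma_sets (space ?P) {U. openin ?S U} \<subseteq> sets ?P"
    using open_P by (intro sets.sigma_sets_subset) auto
  ultimately show "A \<in> sets ?P" by blast
next
  fix A assume A: "A \<in> sets ?P"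
  \<comment> \<open>This map is the identity; its measurability between the two sigma-algebras is
    precisely the inclusion wanted, and it can be checked coordinate by coordinate.\<close>
  have "(\<lambda>x i. x i) \<in> borel_of ?S \<rightarrow>\<^sub>M ?P"
    by (intro measurable_PiM_single' continuous_map_measurable continuous_map_product_projection) auto
  from measurable_sets[OF this A] show "A \<in> sets (borel_of ?S)"
    using sets.sets_into_space[OF A] by (simp add: space_PiM Int_absorb2)
qed

section \<open>Integrals of cylinder functions against powers\<close>

lemma PiM_prob_measures:
  assumes T: "second_countable T" and I: "countable I" and \<mu>: "\<mu> \<in> prob_measures T"
  shows "PiM I (\<lambda>_. \<mu>) \<in> prob_measures (product_topology (\<lambda>_. T) I)"
proof -
  have "sets (PiM I (\<lambda>_. \<mu>)) = sets (PiM I (\<lambda>_. borel_of T))"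
    using prob_measuresD(2)[OF \<mu>] by (intro sets_PiM_cong) auto
  then show ?thesis
    using prob_space_PiM[of I "\<lambda>_. \<mu>"] prob_measuresD(1)[OF \<mu>] sets_borel_of_product_topology[OF T I]
    by (simp add: prob_measures_def)
qed

text \<open>The index set \<open>I\<close> may be infinite; pushing the measure forward to the
  coordinates in \<open>F\<close> leaves a finite product, on which Fubini applies.\<close>

lemma integral_PiM_cylinder:
  fixes \<phi> :: "'i \<Rightarrow> 'a \<Rightarrow> real"
  assumes \<mu>: "prob_space \<mu>" and F: "finite F" "F \<subseteq> I" and \<phi>: "\<And>i. i \<in> F \<Longrightarrow> integrable \<mu> (\<phi> i)"
  shows "(\<integral>x. (\<Prod>i\<in>F. \<phi> i (x i)) \<partial>PiM I (\<lambda>_. \<mu>)) = (\<Prod>i\<in>F. \<integral>x. \<phi> i x \<partial>\<mu>)"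
proof -
  interpret product_prob_space "\<lambda>_. \<mu>" I
    using \<mu> by (intro product_prob_spaceI)
  have [measurable]: "\<phi> i \<in> borel_measurable \<mu>" if "i \<in> F" for i
    using \<phi>[OF that] by simp
  have "(\<integral>x. (\<Prod>i\<in>F. \<phi> i (x i)) \<partial>PiM I (\<lambda>_. \<mu>)) =
      (\<integral>x. (\<Prod>i\<in>F. \<phi> i (restrict x F i)) \<partial>PiM I (\<lambda>_. \<mu>))"
    by (intro Bochner_Integration.integral_cong prod.cong) auto
  also have "\<dots> = (\<integral>x. (\<Prod>i\<in>F. \<phi> i (x i)) \<partial>distr (PiM I (\<lambda>_. \<mu>)) (PiM F (\<lambda>_. \<mu>)) (\<lambda>x. restrict x F))"
    using F(2) by (intro integral_distr[symmetric] measurable_restrict_subset borel_measurable_prod) measurable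
  also have "\<dots> = (\<integral>x. (\<Prod>i\<in>F. \<phi> i (x i)) \<partial>PiM F (\<lambda>_. \<mu>))"
    using F by (simp add: distr_PiM_restrict_finite)
  also have "\<dots> = (\<Prod>i\<in>F. \<integral>x. \<phi> i x \<partial>\<mu>)"
    using F(1) \<phi> by (rule product_integral_prod)
  finally show ?thesis .
qed


definition cylinder_functions :: "'a topology \<Rightarrow> 'i set \<Rightarrow> (('i \<Rightarrow> 'a) \<Rightarrow> real) set" where
  "cylinder_functions T I = {\<lambda>x. \<Prod>i\<in>F. \<phi> i (x i) | F \<phi>. finite F \<and> F \<subseteq> I \<and>
     (\<forall>i\<in>F. continuous_map T euclideanreal (\<phi> i) \<and> bounded (\<phi> i ` topspace T))}"

lemma cylinder_functionsE:
  assumes "h \<in> cylinder_functions T I"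
  obtains F \<phi> where "finite F" "F \<subseteq> I" "h = (\<lambda>x. \<Prod>i\<in>F. \<phi> i (x i))"
    "\<And>i. i \<in> F \<Longrightarrow> continuous_map T euclideanreal (\<phi> i)" "\<And>i. i \<in> F \<Longrightarrow> bounded (\<phi> i ` topspace T)"
  using assms unfolding cylinder_functions_def by blast

lemma cylinder_functionsI:
  assumes "finite F" "F \<subseteq> I" "\<And>i. i \<in> F \<Longrightarrow> continuous_map T euclideanreal (\<phi> i)"
    "\<And>i. i \<in> F \<Longrightarrow> bounded (\<phi> i ` topspace T)"
  shows "(\<lambda>x. \<Prod>i\<in>F. \<phi> i (x i)) \<in> cylinder_functions T I"
  using assms unfolding cylinder_functions_def by blast

lemma bounded_mult_image:
  fixes f g :: "'a \<Rightarrow> real"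
  assumes "bounded (f ` S)" "bounded (g ` S)"
  shows "bounded ((\<lambda>x. f x * g x) ` S)"
proof -
  obtain a b where "\<And>x. x \<in> S \<Longrightarrow> \<bar>f x\<bar> \<le> a" "\<And>x. x \<in> S \<Longrightarrow> \<bar>g x\<bar> \<le> b"
    using assms by (auto simp: bounded_iff)
  then have "\<bar>f x * g x\<bar> \<le> a * b" if "x \<in> S" for x
    unfolding abs_mult using that by (intro mult_mono) (force intro: order_trans[OF abs_ge_zero])+
  then show ?thesis
    by (auto simp: bounded_iff)
qed

lemma cylinder_functions_mult:
  assumes "g \<in> cylinder_functions T I" "h \<in> cylinder_functions T I"
  shows "(\<lambda>x. g x * h x) \<in> cylinder_functions T I"
proof -
  obtain F \<phi> where F: "finite F" "F \<subseteq> I" "g = (\<lambda>x. \<Prod>i\<in>F. \<phi> i (x i))"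
    "\<And>i. i \<in> F \<Longrightarrow> continuous_map T euclideanreal (\<phi> i)" "\<And>i. i \<in> F \<Longrightarrow> bounded (\<phi> i ` topspace T)"
    using assms(1) by (rule cylinder_functionsE) blast
  obtain G \<psi> where G: "finite G" "G \<subseteq> I" "h = (\<lambda>x. \<Prod>i\<in>G. \<psi> i (x i))"
    "\<And>i. i \<in> G \<Longrightarrow> continuous_map T euclideanreal (\<psi> i)" "\<And>i. i \<in> G \<Longrightarrow> bounded (\<psi> i ` topspace T)"
    using assms(2) by (rule cylinder_functionsE) blast
  \<comment> \<open>Padding by the neutral factor 1 brings both products to the common index set
    \<open>F \<union> G\<close>.\<close>
  define \<theta> where "\<theta> i x = (if i \<in> F then \<phi> i x else 1) * (if i \<in> G then \<psi> i x else 1)" for i x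
  have "(\<lambda>x. g x * h x) = (\<lambda>x. \<Prod>i\<in>F \<union> G. \<theta> i (x i))"
  proof
    fix x
    have "(\<Prod>i\<in>F. \<phi> i (x i)) = (\<Prod>i\<in>F \<union> G. if i \<in> F then \<phi> i (x i) else 1)"
      using F(1) G(1) by (intro prod.mono_neutral_cong_left) auto
    moreover have "(\<Prod>i\<in>G. \<psi> i (x i)) = (\<Prod>i\<in>F \<union> G. if i \<in> G then \<psi> i (x i) else 1)"
      using F(1) G(1) by (intro prod.mono_neutral_cong_left) auto
    ultimately show "g x * h x = (\<Prod>i\<in>F \<union> G. \<theta> i (x i))"
      by (simp only: F(3) G(3) \<theta>_def prod.distrib)
  qed
  moreover have "(\<lambda>x. \<Prod>i\<in>F \<union> G. \<theta> i (x i)) \<in> cylinder_functions T I"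
  proof (rule cylinder_functionsI)
    fix i
    have "continuous_map T euclideanreal (\<lambda>x. if i \<in> F then \<phi> i x else 1)"
      "continuous_map T euclideanreal (\<lambda>x. if i \<in> G then \<psi> i x else 1)"
      using F(4)[of i] G(4)[of i] by (cases "i \<in> F"; cases "i \<in> G"; simp)+
    then show "continuous_map T euclideanreal (\<theta> i)"
      unfolding \<theta>_def by (rule continuous_map_real_mult)
    have one: "bounded ((\<lambda>_. 1 :: real) ` topspace T)"
      by (rule bounded_subset[of "{1}"]) auto
    have "bounded ((\<lambda>x. if i \<in> F then \<phi> i x else 1) ` topspace T)"
      using F(5)[of i] one by (cases "i \<in> F") simp_all
    moreover have "bounded ((\<lambda>x. if i \<in> G then \<psi> i x else 1) ` topspace T)"
      using G(5)[of i] one by (cases "i \<in> G") simp_all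
    ultimately show "bounded (\<theta> i ` topspace T)"
      unfolding \<theta>_def by (rule bounded_mult_image)
  qed (use F G in auto)
  ultimately show ?thesis
    by (simp only:)
qed

lemma cylinder_functions_continuous:
  assumes "h \<in> cylinder_functions T I"
  shows "continuous_map (product_topology (\<lambda>_. T) I) euclideanreal h"
    and "bounded (h ` topspace (product_topology (\<lambda>_. T) I))"
proof -
  obtain F \<phi> where F: "finite F" "F \<subseteq> I" and h: "h = (\<lambda>x. \<Prod>i\<in>F. \<phi> i (x i))"
    and \<phi>: "\<And>i. i \<in> F \<Longrightarrow> continuous_map T euclideanreal (\<phi> i)" "\<And>i. i \<in> F \<Longrightarrow> bounded (\<phi> i ` topspace T)"
    using assms by (rule cylinder_functionsE) blast
  have "continuous_map (product_topology (\<lambda>_. T) I) euclideanreal (\<lambda>x. \<phi> i (x i))" if "i \<in> F" for i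
  proof -
    have "continuous_map (product_topology (\<lambda>_. T) I) T (\<lambda>x. x i)"
      using F(2) that by (intro continuous_map_product_projection) blast
    from continuous_map_compose[OF this \<phi>(1)[OF that]] show ?thesis
      by (simp add: o_def)
  qed
  then show "continuous_map (product_topology (\<lambda>_. T) I) euclideanreal h"
    unfolding h using F(1) by (rule continuous_map_prod[rotated])
  show "bounded (h ` topspace (product_topology (\<lambda>_. T) I))"
    unfolding h using F \<phi>(2)
  proof (induction F)
    case empty
    show ?case by (rule bounded_subset[of "{1}"]) auto
  next
    case (insert j F)
    have "(\<lambda>x. \<phi> j (x j)) ` topspace (product_topology (\<lambda>_. T) I) \<subseteq> \<phi> j ` topspace T"
      using insert.prems(1) by (auto simp: PiE_iff)
    then have "bounded ((\<lambda>x. \<phi> j (x j)) ` topspace (product_topology (\<lambda>_. T) I))"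
      using insert.prems(2)[of j] bounded_subset by blast
    moreover have "bounded ((\<lambda>x. \<Prod>i\<in>F. \<phi> i (x i)) ` topspace (product_topology (\<lambda>_. T) I))"
      using insert.prems by (intro insert.IH) auto
    ultimately have "bounded ((\<lambda>x. \<phi> j (x j) * (\<Prod>i\<in>F. \<phi> i (x i))) ` topspace (product_topology (\<lambda>_. T) I))"
      by (rule bounded_mult_image)
    then show ?case
      using insert.hyps by simp
  qed
qed

lemma bounded_continuous_integrable:
  assumes "\<mu> \<in> prob_measures T" "continuous_map T euclideanreal f" "bounded (f ` topspace T)"
  shows "integrable \<mu> f"
proof -
  obtain b where "\<And>x. x \<in> topspace T \<Longrightarrow> \<bar>f x\<bar> \<le> b"
    using assms(3) by (auto simp: bounded_iff)
  then show ?thesis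
    using prob_measures_integrable[OF assms(1) continuous_map_borel_measurable[OF assms(2)]] by blast
qed

text \<open>Each of the finitely many factors converges by weak convergence on \<open>T\<close>. The
  factorisation is applied only where \<open>\<mu> z\<close> is a law, which holds eventually along
  \<open>Z\<close>.\<close>

lemma tendsto_integral_cylinder_function:
  assumes lim: "limitin (weak_topology T) \<mu> \<nu> Z" and h: "h \<in> cylinder_functions T I"
  shows "((\<lambda>z. \<integral>x. h x \<partial>PiM I (\<lambda>_. \<mu> z)) \<longlongrightarrow> (\<integral>x. h x \<partial>PiM I (\<lambda>_. \<nu>))) Z"
proof -
  obtain F \<phi> where F: "finite F" "F \<subseteq> I" and h: "h = (\<lambda>x. \<Prod>i\<in>F. \<phi> i (x i))"
    and \<phi>: "\<And>i. i \<in> F \<Longrightarrow> continuous_map T euclideanreal (\<phi> i)" "\<And>i. i \<in> F \<Longrightarrow> bounded (\<phi> i ` topspace T)"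
    using h by (rule cylinder_functionsE) blast
  have lim: "\<nu> \<in> prob_measures T" "eventually (\<lambda>z. \<mu> z \<in> prob_measures T) Z"
    "\<And>i. i \<in> F \<Longrightarrow> ((\<lambda>z. \<integral>x. \<phi> i x \<partial>\<mu> z) \<longlongrightarrow> (\<integral>x. \<phi> i x \<partial>\<nu>)) Z"
    using lim \<phi> unfolding limitin_weak_topology by blast+
  have eq: "(\<integral>x. h x \<partial>PiM I (\<lambda>_. \<kappa>)) = (\<Prod>i\<in>F. \<integral>x. \<phi> i x \<partial>\<kappa>)" if "\<kappa> \<in> prob_measures T" for \<kappa>
    unfolding h using F prob_measuresD(1)[OF that]
    by (intro integral_PiM_cylinder bounded_continuous_integrable[OF that] \<phi>)
  have "((\<lambda>z. \<Prod>i\<in>F. \<integral>x. \<phi> i x \<partial>\<mu> z) \<longlongrightarrow> (\<Prod>i\<in>F. \<integral>x. \<phi> i x \<partial>\<nu>)) Z"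
    using lim(3) by (rule tendsto_prod)
  then show ?thesis
    unfolding eq[OF lim(1)]
    by (rule Lim_transform_eventually) (use lim(2) in eventually_elim, simp add: eq)
qed

text \<open>
  The prefactor \<open>g\<close> makes the induction work: \<open>g (1 - h) P = g P - (g h) P\<close>, where \<open>g h\<close> is again a
  cylinder function.
\<close>

lemma tendsto_integral_cylinder_algebra:
  assumes T: "second_countable T" and I: "countable I"
    and lim: "limitin (weak_topology T) \<mu> \<nu> Z"
    and J: "finite J" "\<And>j. j \<in> J \<Longrightarrow> h j \<in> cylinder_functions T I"
    and g: "g \<in> cylinder_functions T I"
  defines "S \<equiv> product_topology (\<lambda>_. T) I"
  shows "continuous_map S euclideanreal (\<lambda>x. g x * (\<Prod>j\<in>J. 1 - h j x)) \<and>
    bounded ((\<lambda>x. g x * (\<Prod>j\<in>J. 1 - h j x)) ` topspace S) \<and>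
    ((\<lambda>z. \<integral>x. g x * (\<Prod>j\<in>J. 1 - h j x) \<partial>PiM I (\<lambda>_. \<mu> z)) \<longlongrightarrow>
      (\<integral>x. g x * (\<Prod>j\<in>J. 1 - h j x) \<partial>PiM I (\<lambda>_. \<nu>))) Z"
  using J g
proof (induction J arbitrary: g)
  case empty
  then show ?case
    using cylinder_functions_continuous[of g T I] tendsto_integral_cylinder_function[OF lim, of g I]
    by (simp add: S_def)
next
  case (insert j J)
  let ?P = "\<lambda>x. \<Prod>j\<in>J. 1 - h j x"
  let ?a = "\<lambda>x. g x * ?P x" and ?b = "\<lambda>x. (g x * h j x) * ?P x"
  have a: "continuous_map S euclideanreal ?a" "bounded (?a ` topspace S)"
    "((\<lambda>z. \<integral>x. ?a x \<partial>PiM I (\<lambda>_. \<mu> z)) \<longlongrightarrow> (\<integral>x. ?a x \<partial>PiM I (\<lambda>_. \<nu>))) Z"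
    using insert.IH[of g] insert.prems by simp_all
  have b: "continuous_map S euclideanreal ?b" "bounded (?b ` topspace S)"
    "((\<lambda>z. \<integral>x. ?b x \<partial>PiM I (\<lambda>_. \<mu> z)) \<longlongrightarrow> (\<integral>x. ?b x \<partial>PiM I (\<lambda>_. \<nu>))) Z"
    using insert.IH[of "\<lambda>x. g x * h j x"] insert.prems cylinder_functions_mult[of g T I "h j"] by simp_all
  have eq: "(\<lambda>x. g x * (\<Prod>j\<in>insert j J. 1 - h j x)) = (\<lambda>x. ?a x - ?b x)"
    using insert.hyps by (auto simp: algebra_simps)
  have int: "(\<integral>x. ?a x - ?b x \<partial>PiM I (\<lambda>_. \<kappa>)) = (\<integral>x. ?a x \<partial>PiM I (\<lambda>_. \<kappa>)) - (\<integral>x. ?b x \<partial>PiM I (\<lambda>_. \<kappa>))"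
    if "\<kappa> \<in> prob_measures T" for \<kappa>
    using bounded_continuous_integrable[OF PiM_prob_measures[OF T I that]] a(1,2) b(1,2)
    unfolding S_def by (intro Bochner_Integration.integral_diff) blast+
  have \<nu>: "\<nu> \<in> prob_measures T" "eventually (\<lambda>z. \<mu> z \<in> prob_measures T) Z"
    using lim by (simp_all add: limitin_weak_topology)
  have "((\<lambda>z. (\<integral>x. ?a x \<partial>PiM I (\<lambda>_. \<mu> z)) - (\<integral>x. ?b x \<partial>PiM I (\<lambda>_. \<mu> z))) \<longlongrightarrow>
      (\<integral>x. ?a x \<partial>PiM I (\<lambda>_. \<nu>)) - (\<integral>x. ?b x \<partial>PiM I (\<lambda>_. \<nu>))) Z"
    using a(3) b(3) by (rule tendsto_diff)
  then have "((\<lambda>z. \<integral>x. ?a x - ?b x \<partial>PiM I (\<lambda>_. \<mu> z)) \<longlongrightarrow> (\<integral>x. ?a x - ?b x \<partial>PiM I (\<lambda>_. \<nu>))) Z"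
    unfolding int[OF \<nu>(1)]
    by (rule Lim_transform_eventually) (use \<nu>(2) in eventually_elim, simp only: int)
  moreover have "continuous_map S euclideanreal (\<lambda>x. ?a x - ?b x)"
    using a(1) b(1) by (rule continuous_map_diff)
  moreover have "bounded ((\<lambda>x. ?a x - ?b x) ` topspace S)"
    using a(2) b(2) by (rule bounded_minus_comp)
  ultimately show ?case
    unfolding eq by blast
qed


text \<open>A bump for a box is the product of bumps for its sides, hence a cylinder function; soft
  unions of such bumps approximate all open sets of the product and lie in the algebra where
  convergence is known. An infinite \<open>I\<close> does no harm, as each test function sees
  finitely many coordinates. The limit is along an arbitrary filter so that continuity of the power
  map can be read off.\<close>

lemma limitin_PiM:
  fixes T :: "'a topology" and I :: "'i set"
  assumes T: "metrizable_space T" "second_countable T" and I: "countable I"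
    and lim: "limitin (weak_topology T) \<mu> \<nu> Z"
  shows "limitin (weak_topology (product_topology (\<lambda>_. T) I))
    (\<lambda>z. PiM I (\<lambda>_. \<mu> z)) (PiM I (\<lambda>_. \<nu>)) Z"
proof -
  let ?S = "product_topology (\<lambda>_. T) I"
  obtain \<B> where \<B>: "countable \<B>" "\<And>V. V \<in> \<B> \<Longrightarrow> openin T V"
    "\<And>U x. openin T U \<Longrightarrow> x \<in> U \<Longrightarrow> \<exists>V\<in>\<B>. x \<in> V \<and> V \<subseteq> U"
    by (rule second_countableE[OF T(2)]) blast
  define K where "K = (SIGMA F:{F. finite F \<and> F \<subseteq> I}. F \<rightarrow>\<^sub>E \<B>)"
  obtain \<psi> where \<psi>: "\<And>V k. openin T V \<Longrightarrow> \<psi> V k \<in> {f. continuous_map T euclideanreal f \<and> bounded (f ` topspace T)}"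
    "\<And>V k x. openin T V \<Longrightarrow> x \<in> topspace T \<Longrightarrow> 0 \<le> \<psi> V k x"
    "\<And>V k x. openin T V \<Longrightarrow> x \<in> topspace T \<Longrightarrow> \<psi> V k x \<le> indicator V x"
    "\<And>V x. openin T V \<Longrightarrow> x \<in> topspace T \<Longrightarrow> (\<lambda>k. \<psi> V k x) \<longlonglongrightarrow> indicator V x"
    by (rule lower_approximates_choice[OF metrizable_lower_approximates[OF T(1)]]) blast
  define h where "h = (\<lambda>(F :: 'i set, V) k x. \<Prod>i\<in>F. \<psi> (V i) k (x i) :: real)"
  define box where "box = (\<lambda>(F, V). cylinder_box T I F V)"
  define \<A> where "\<A> = {\<lambda>x. 1 - (\<Prod>j\<in>J. 1 - h j k x) | J k. finite J \<and> J \<subseteq> K}"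
  have K: "finite F" "F \<subseteq> I" "i \<in> F \<Longrightarrow> openin T (V i)" if "(F, V) \<in> K" for F V i
    using that \<B>(2) by (auto simp: K_def)
  have h_cyl: "h j k \<in> cylinder_functions T I" if "j \<in> K" for j k
  proof (cases j)
    case (Pair F V)
    then show ?thesis
      unfolding h_def Pair prod.case using K[OF that[unfolded Pair]] \<psi>(1)
      by (intro cylinder_functionsI) auto
  qed
  have approx: "lower_approximates ?S \<A>"
    unfolding \<A>_def
  proof (rule lower_approximates_base[where B=box])
    show "countable K"
      unfolding K_def using I \<B>(1) by (rule countable_cylinder_index)
    show "\<exists>j\<in>K. x \<in> box j \<and> box j \<subseteq> U" if U: "openin ?S U" and x: "x \<in> U" for U x
    proof -
      obtain F V where "finite F" "F \<subseteq> I" "V \<in> F \<rightarrow>\<^sub>E \<B>"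
        "x \<in> cylinder_box T I F V" "cylinder_box T I F V \<subseteq> U"
        by (rule product_topology_cylinder_base[OF _ U x, of \<B>, OF \<B>(3)])
      then show ?thesis
        by (intro bexI[of _ "(F, V)"]) (simp_all add: K_def box_def)
    qed
    fix j x assume j: "j \<in> K" and x: "x \<in> topspace ?S"
    obtain F V where FV: "j = (F, V)" by (cases j)
    have xi: "x i \<in> topspace T" "openin T (V i)" if "i \<in> F" for i
      using K[of F V] j that x FV by (auto simp: PiE_iff)
    show 0: "0 \<le> h j k x" for k
      unfolding h_def FV prod.case using xi \<psi>(2) by (intro prod_nonneg) blast
    show "h j k x \<le> indicator (box j) x" for k
    proof (cases "x \<in> box j")
      case True
      have "(\<Prod>i\<in>F. \<psi> (V i) k (x i)) \<le> 1"
        using \<psi>(2)[OF xi(2,1)] order_trans[OF \<psi>(3)[OF xi(2,1)] indicator_le_1]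
        by (intro prod_le_1 conjI)
      then show ?thesis
        using True by (simp add: h_def FV)
    next
      case False
      then obtain i where i: "i \<in> F" "x i \<notin> V i"
        using x by (auto simp: box_def FV cylinder_box_def)
      then have "\<psi> (V i) k (x i) = 0"
        using \<psi>(2)[OF xi(2)[OF i(1)] xi(1)[OF i(1)], of k] \<psi>(3)[OF xi(2)[OF i(1)] xi(1)[OF i(1)], of k] by simp
      then have "h j k x = 0"
        using i(1) K(1)[of F V] j by (auto simp: h_def FV)
      then show ?thesis by simp
    qed
    assume "x \<in> box j"
    then have "(\<lambda>k. \<psi> (V i) k (x i)) \<longlonglongrightarrow> 1" if "i \<in> F" for i
      using \<psi>(4)[OF xi(2)[OF that] xi(1)[OF that]] that by (simp add: box_def FV cylinder_box_def)
    then have "(\<lambda>k. \<Prod>i\<in>F. \<psi> (V i) k (x i)) \<longlonglongrightarrow> (\<Prod>i\<in>F. 1)"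
      by (rule tendsto_prod)
    then show "(\<lambda>k. h j k x) \<longlonglongrightarrow> 1"
      by (simp add: h_def FV)
  qed
  have g: "continuous_map ?S euclideanreal g"
    "((\<lambda>z. \<integral>x. g x \<partial>PiM I (\<lambda>_. \<mu> z)) \<longlongrightarrow> (\<integral>x. g x \<partial>PiM I (\<lambda>_. \<nu>))) Z" if gA: "g \<in> \<A>" for g
  proof -
    obtain J k where J: "finite J" "J \<subseteq> K" and g: "g = (\<lambda>x. 1 - (\<Prod>j\<in>J. 1 - h j k x))"
      using gA unfolding \<A>_def by blast
    let ?P = "\<lambda>x. \<Prod>j\<in>J. 1 - h j k x"
    \<comment> \<open>The constant 1, as an empty product, is the prefactor with which the algebra
      lemma gives the bare product \<open>?P\<close>.\<close>
    have one: "(\<lambda>_. 1) \<in> cylinder_functions T I"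
      using cylinder_functionsI[of "{}" I T] by simp
    have P: "continuous_map ?S euclideanreal ?P" "bounded (?P ` topspace ?S)"
      "((\<lambda>z. \<integral>x. ?P x \<partial>PiM I (\<lambda>_. \<mu> z)) \<longlongrightarrow> (\<integral>x. ?P x \<partial>PiM I (\<lambda>_. \<nu>))) Z"
      using tendsto_integral_cylinder_algebra[OF T(2) I lim J(1) _ one, of "\<lambda>j. h j k"] h_cyl J(2)
      by auto
    show "continuous_map ?S euclideanreal g"
      unfolding g using P(1) by (intro continuous_map_diff) auto
    have int: "(\<integral>x. g x \<partial>PiM I (\<lambda>_. \<kappa>)) = 1 - (\<integral>x. ?P x \<partial>PiM I (\<lambda>_. \<kappa>))" if \<kappa>: "\<kappa> \<in> prob_measures T" for \<kappa>
    proof -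
      note PM = PiM_prob_measures[OF T(2) I \<kappa>]
      interpret prob_space "PiM I (\<lambda>_. \<kappa>)"
        by (rule prob_measuresD(1)[OF PM])
      show ?thesis
        unfolding g using bounded_continuous_integrable[OF PM P(1,2)]
        by (subst Bochner_Integration.integral_diff) (simp_all add: prob_space)
    qed
    have \<nu>: "\<nu> \<in> prob_measures T" "eventually (\<lambda>z. \<mu> z \<in> prob_measures T) Z"
      using lim by (simp_all add: limitin_weak_topology)
    have "((\<lambda>z. 1 - (\<integral>x. ?P x \<partial>PiM I (\<lambda>_. \<mu> z))) \<longlongrightarrow> 1 - (\<integral>x. ?P x \<partial>PiM I (\<lambda>_. \<nu>))) Z"
      using tendsto_const P(3) by (rule tendsto_diff)
    then show "((\<lambda>z. \<integral>x. g x \<partial>PiM I (\<lambda>_. \<mu> z)) \<longlongrightarrow> (\<integral>x. g x \<partial>PiM I (\<lambda>_. \<nu>))) Z"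
      unfolding int[OF \<nu>(1)]
      by (rule Lim_transform_eventually) (use \<nu>(2) in eventually_elim, simp only: int)
  qed
  show ?thesis
  proof (rule portmanteau_lower_approximates[OF approx _ g(2)])
    show "\<A> \<subseteq> borel_measurable (borel_of ?S)"
      using g(1) continuous_map_borel_measurable by blast
    show "PiM I (\<lambda>_. \<nu>) \<in> prob_measures ?S"
      using lim PiM_prob_measures[OF T(2) I] by (simp add: limitin_weak_topology)
    show "eventually (\<lambda>z. PiM I (\<lambda>_. \<mu> z) \<in> prob_measures ?S) Z"
      using lim PiM_prob_measures[OF T(2) I] by (auto simp: limitin_weak_topology elim: eventually_mono)
  qed
qed

section \<open>Continuity of the power map and measurability of evaluations\<close>

lemma continuous_map_PiM:
  assumes "metrizable_space T" "second_countable T" "countable I"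
  shows "continuous_map (weak_topology T) (weak_topology (product_topology (\<lambda>_. T) I)) (\<lambda>\<mu>. PiM I (\<lambda>_. \<mu>))"
  unfolding continuous_map_atin
proof
  fix \<mu> assume "\<mu> \<in> topspace (weak_topology T)"
  then have "limitin (weak_topology T) (\<lambda>\<mu>. \<mu>) \<mu> (atin (weak_topology T) \<mu>)"
    using limitin_continuous_map[OF continuous_map_id, of \<mu> "weak_topology T" \<mu>] by (simp add: id_def)
  then show "limitin (weak_topology (product_topology (\<lambda>_. T) I)) (\<lambda>\<mu>. PiM I (\<lambda>_. \<mu>)) (PiM I (\<lambda>_. \<mu>))
      (atin (weak_topology T) \<mu>)"
    by (rule limitin_PiM[OF assms])
qed

text \<open>This links the Borel structure of the weak topology with \<open>prob_algebra\<close>,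
  where kernels and bind live. Open sets are an intersection-stable generator, and the mass of an
  open set is a pointwise limit of integrals of bounded continuous functions, each weakly continuous
  in the law.\<close>

lemma measurable_weak_topology_prob_algebra:
  assumes S: "metrizable_space S"
  shows "(\<lambda>\<mu>. \<mu>) \<in> borel_of (weak_topology S) \<rightarrow>\<^sub>M prob_algebra (borel_of S)"
proof (rule measurable_prob_algebra_generated[OF sets_borel_of])
  show "Int_stable {U. openin S U}"
    by (auto simp: Int_stable_def)
  show "{U. openin S U} \<subseteq> Pow (topspace S)"
    by (auto dest: openin_subset)
  fix \<mu> assume "\<mu> \<in> space (borel_of (weak_topology S))"
  then have "\<mu> \<in> prob_measures S" by simp
  then show "prob_space \<mu>" "sets \<mu> = sets (borel_of S)"
    by (rule prob_measuresD)+
next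
  fix U assume "U \<in> {U. openin S U}"
  then have U: "openin S U" by simp
  obtain g where g: "\<And>k. g k \<in> {f. continuous_map S euclideanreal f \<and> bounded (f ` topspace S)}"
    "\<And>k x. x \<in> topspace S \<Longrightarrow> 0 \<le> g k x"
    "\<And>k x. x \<in> topspace S \<Longrightarrow> g k x \<le> indicator U x"
    "\<And>x. x \<in> topspace S \<Longrightarrow> (\<lambda>k. g k x) \<longlonglongrightarrow> indicator U x"
    by (rule lower_approximatesE[OF metrizable_lower_approximates[OF S] U]) blast
  have "(\<lambda>\<mu>. measure \<mu> U) \<in> borel_measurable (borel_of (weak_topology S))"
  proof (rule borel_measurable_LIMSEQ_metric)
    show "(\<lambda>\<mu>. \<integral>x. g k x \<partial>\<mu>) \<in> borel_measurable (borel_of (weak_topology S))" for k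
      using g(1)[of k] by (intro continuous_map_borel_measurable continuous_map_integral) auto
    fix \<mu> assume "\<mu> \<in> space (borel_of (weak_topology S))"
    then have \<mu>: "\<mu> \<in> prob_measures S" by simp
    have "g k \<in> borel_measurable (borel_of S)" for k
      using g(1)[of k] by (intro continuous_map_borel_measurable) auto
    then show "(\<lambda>k. \<integral>x. g k x \<partial>\<mu>) \<longlonglongrightarrow> measure \<mu> U"
      by (rule lower_approximates_integral_limit(1)[OF U _ _ _ _ \<mu>]; use g in blast)
  qed
  then have "(\<lambda>\<mu>. ennreal (measure \<mu> U)) \<in> borel_measurable (borel_of (weak_topology S))"
    by (rule measurable_compose[OF _ measurable_ennreal])
  then show "(\<lambda>\<mu>. emeasure \<mu> U) \<in> borel_measurable (borel_of (weak_topology S))"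
  proof (rule measurable_cong[THEN iffD1, rotated])
    fix \<mu> assume "\<mu> \<in> space (borel_of (weak_topology S))"
    then have \<mu>: "\<mu> \<in> prob_measures S" by simp
    interpret prob_space \<mu> by (rule prob_measuresD(1)[OF \<mu>])
    show "ennreal (measure \<mu> U) = emeasure \<mu> U"
      by (simp add: emeasure_eq_measure)
  qed
qed

section \<open>Mixtures and convergence to a point mass\<close>

text \<open>Only neighbourhoods of \<open>a\<close> carry information: an open set that misses
  \<open>a\<close> has mass 0 under the point mass, so its lower bound is trivial, and one that
  contains \<open>a\<close> contains a base set around \<open>a\<close>.\<close>

lemma limitin_weak_topology_returnI:
  assumes base: "\<And>U. openin S U \<Longrightarrow> a \<in> U \<Longrightarrow> \<exists>V\<in>\<B>. a \<in> V \<and> V \<subseteq> U"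
    and a: "a \<in> topspace S" and ev: "eventually (\<lambda>i. \<kappa> i \<in> prob_measures S) F"
    and lim: "\<And>V. V \<in> \<B> \<Longrightarrow> a \<in> V \<Longrightarrow> ((\<lambda>i. measure (\<kappa> i) V) \<longlongrightarrow> 1) F"
  shows "limitin (weak_topology S) \<kappa> (return (borel_of S) a) F"
proof (rule portmanteau_open[OF _ _ ev])
  show "return (borel_of S) a \<in> prob_measures S"
    using a by (simp add: prob_measures_def prob_space_return)
  fix U and e :: real assume U: "openin S U" and e: "0 < e"
  have U_sets: "U \<in> sets (borel_of S)"
    by (rule openin_sets_borel_of[OF U])
  show "eventually (\<lambda>i. measure (return (borel_of S) a) U - e < measure (\<kappa> i) U) F"
  proof (cases "a \<in> U")
    case True
    obtain V where V: "V \<in> \<B>" "a \<in> V" "V \<subseteq> U"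
      using base[OF U True] by blast
    have "eventually (\<lambda>i. 1 - e < measure (\<kappa> i) V) F"
      using e by (intro order_tendstoD(1)[OF lim[OF V(1,2)]]) simp
    then show ?thesis
      using ev
    proof eventually_elim
      case (elim i)
      interpret prob_space "\<kappa> i" by (rule prob_measuresD(1)[OF elim(2)])
      have "measure (\<kappa> i) V \<le> measure (\<kappa> i) U"
        using V(3) U_sets prob_measuresD(2)[OF elim(2)] by (intro finite_measure_mono) auto
      then show ?case
        using elim(1) True U_sets by (simp add: measure_return)
    qed
  next
    case False
    then have "measure (return (borel_of S) a) U = 0"
      using U_sets by (simp add: measure_return)
    then have "measure (return (borel_of S) a) U - e < measure (\<kappa> i) U" for i
      using e measure_nonneg[of "\<kappa> i" U] by linarith
    then show ?thesis by simp
  qed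
qed

lemma limitin_weak_topology_return:
  assumes "limitin S y a F"
  shows "limitin (weak_topology S) (\<lambda>i. return (borel_of S) (y i)) (return (borel_of S) a) F"
proof (rule limitin_weak_topology_returnI[where \<B>="{V. openin S V}"])
  show a: "a \<in> topspace S"
    using assms by (simp add: limitin_def)
  have "eventually (\<lambda>i. y i \<in> topspace S) F"
    using assms openin_topspace[of S] unfolding limitin_def by blast
  then show "eventually (\<lambda>i. return (borel_of S) (y i) \<in> prob_measures S) F"
    by eventually_elim (simp add: prob_measures_def prob_space_return)
  fix V assume V: "V \<in> {V. openin S V}" "a \<in> V"
  then have "eventually (\<lambda>i. y i \<in> V) F"
    using assms by (simp add: limitin_def)
  then have "eventually (\<lambda>i. measure (return (borel_of S) (y i)) V = 1) F"
    by (rule eventually_mono) (use V(1) in \<open>simp add: measure_return openin_sets_borel_of\<close>)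
  then show "((\<lambda>i. measure (return (borel_of S) (y i)) V) \<longlongrightarrow> 1) F"
    by (rule tendsto_eventually)
qed auto

text \<open>Compatibility with the topology controls distances only near a fixed limit, so it is the
  common limit \<open>l\<close> that makes the two families merge.\<close>

lemma metrizes_tendsto:
  assumes "metrizes d S" "limitin S f l F" "limitin S g l F"
  shows "((\<lambda>i. d (f i) (g i)) \<longlongrightarrow> 0) F"
proof -
  interpret Metric_space "topspace S" d
    using assms(1) by (simp add: metrizes_def)
  have S: "mtopology = S"
    using assms(1) by (simp add: metrizes_def)
  have l: "l \<in> topspace S" "eventually (\<lambda>i. f i \<in> topspace S) F" "eventually (\<lambda>i. g i \<in> topspace S) F"
    and lim: "((\<lambda>i. d (f i) l) \<longlongrightarrow> 0) F" "((\<lambda>i. d (g i) l) \<longlongrightarrow> 0) F"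
    using assms(2,3) limitin_metric_dist_null unfolding S by blast+
  have upper: "((\<lambda>i. d (f i) l + d (g i) l) \<longlongrightarrow> 0) F"
    using tendsto_add[OF lim] by simp
  have le: "eventually (\<lambda>i. d (f i) (g i) \<le> d (f i) l + d (g i) l) F"
    using l(2,3)
  proof eventually_elim
    case (elim i)
    then show ?case
      using triangle[OF elim(1) l(1) elim(2)] commute[of l "g i"] by simp
  qed
  show ?thesis
    by (rule tendsto_sandwich[OF _ le tendsto_const upper]) simp
qed

lemma measurable_power_measure:
  assumes T: "metrizable_space T" "second_countable T" and Q: "Q \<in> prob_measures (weak_topology T)"
  shows "(\<lambda>p. power_measure p m) \<in> Q \<rightarrow>\<^sub>M prob_algebra (borel_of (power_topology T m))"
proof -
  have S: "metrizable_space (power_topology T m)"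
    using T(1) by (simp add: power_topology_def metrizable_space_product_topology)
  have "(\<lambda>p. power_measure p m) \<in> borel_of (weak_topology T) \<rightarrow>\<^sub>M borel_of (weak_topology (power_topology T m))"
    unfolding power_measure_def power_topology_def
    by (intro continuous_map_measurable continuous_map_PiM T) simp
  from measurable_compose[OF this measurable_weak_topology_prob_algebra[OF S]]
  show ?thesis
    using prob_measuresD(2)[OF Q] by (simp cong: measurable_cong_sets)
qed

text \<open>\<open>measure_of\<close> returns the prescribed set function only if that function is
  countably additive. Comparison with the bind supplies this, and makes the integration formula for
  kernels available.\<close>

lemma mixture_eq_bind:
  assumes T: "metrizable_space T" "second_countable T" and Q: "Q \<in> prob_measures (weak_topology T)"
  shows "mixture T m Q = Q \<bind> (\<lambda>p. power_measure p m)"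
proof -
  let ?S = "borel_of (power_topology T m)"
  let ?R = "Q \<bind> (\<lambda>p. power_measure p m)"
  interpret prob_space Q by (rule prob_measuresD(1)[OF Q])
  note meas = measurable_prob_algebraD[OF measurable_power_measure[OF T Q, of m]]
  have sets: "sets ?R = sets ?S" 
    by (rule sets_bind[OF sets_kernel[OF meas] not_empty])
  have space: "space ?R = topspace (power_topology T m)"
    using sets_eq_imp_space_eq[OF sets] by simp
  have "?R = measure_of (space ?R) (sets ?R) (emeasure ?R)"
    by (rule measure_of_of_measure[symmetric])
  also have "\<dots> = measure_of (space ?R) (sets ?R) (\<lambda>C. \<integral>\<^sup>+ p. emeasure (power_measure p m) C \<partial>Q)"
  proof (rule measure_of_eq[OF sets.space_closed])
    fix C assume "C \<in> sigma_sets (space ?R) (sets ?R)"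
    then have "C \<in> sets ?R"
      by (simp only: sets.sigma_sets_eq)
    then have "C \<in> sets ?S"
      by (simp only: sets)
    then show "emeasure ?R C = (\<integral>\<^sup>+ p. emeasure (power_measure p m) C \<partial>Q)"
      by (rule emeasure_bind[OF not_empty meas])
  qed
  also have "\<dots> = mixture T m Q"
    by (simp only: mixture_def sets space)
  finally show ?thesis ..
qed

text \<open>Integrating out the kernel reduces a test function \<open>f\<close> on the power to the
  function \<open>g\<close> on the space of laws. Weak continuity of the power map makes
  \<open>g\<close> bounded and continuous, so it is admissible for the convergence of
  \<open>Q\<close>; against the point mass it integrates to \<open>g p\<close>.\<close>

lemma limitin_mixture:
  assumes T: "metrizable_space T" "second_countable T"
    and lim: "limitin (weak_topology (weak_topology T)) Q (return (borel_of (weak_topology T)) p) F"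
    and p: "p \<in> prob_measures T"
  shows "limitin (weak_topology (power_topology T m)) (\<lambda>i. mixture T m (Q i)) (power_measure p m) F"
  unfolding limitin_weak_topology
proof (intro conjI allI impI)
  let ?W = "weak_topology T" and ?S = "power_topology T m"
  have I: "countable {i. enat i < m}" by simp
  have ev: "eventually (\<lambda>i. Q i \<in> prob_measures ?W) F"
    using lim by (simp add: limitin_weak_topology)
  have mix: "mixture T m R \<in> prob_measures ?S"
    if R: "R \<in> prob_measures ?W" for R
  proof -
    interpret prob_space R by (rule prob_measuresD(1)[OF R])
    note meas = measurable_power_measure[OF T R, of m]
    have "sets (R \<bind> (\<lambda>p. power_measure p m)) = sets (borel_of ?S)"
      by (rule sets_bind[OF sets_kernel[OF measurable_prob_algebraD[OF meas]] not_empty])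
    moreover have "prob_space (R \<bind> (\<lambda>p. power_measure p m))"
      by (rule prob_space_bind'[OF _ meas]) (simp add: space_prob_algebra prob_space_axioms)
    ultimately show ?thesis
      by (simp add: prob_measures_def mixture_eq_bind[OF T R])
  qed
  show "power_measure p m \<in> prob_measures ?S"
    unfolding power_measure_def power_topology_def by (rule PiM_prob_measures[OF T(2) I p])
  show "eventually (\<lambda>i. mixture T m (Q i) \<in> prob_measures ?S) F"
    using ev by eventually_elim (rule mix)
  fix f assume f: "continuous_map ?S euclideanreal f \<and> bounded (f ` topspace ?S)"
  then obtain b where b: "\<And>x. x \<in> topspace ?S \<Longrightarrow> \<bar>f x\<bar> \<le> b"
    by (auto simp: bounded_iff)
  define g where "g r = (\<integral>x. f x \<partial>power_measure r m)" for r
  have int: "(\<integral>x. f x \<partial>mixture T m R) = (\<integral>r. g r \<partial>R)" if R: "R \<in> prob_measures ?W" for R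
  proof -
    interpret prob_space R by (rule prob_measuresD(1)[OF R])
    have "f \<in> borel_measurable (borel_of ?S)"
      using f by (intro continuous_map_borel_measurable) simp
    moreover have "AE r in R. emeasure (power_measure r m) (space (power_measure r m)) \<le> ennreal 1"
    proof (rule AE_I2)
      fix r assume "r \<in> space R"
      then have "prob_space r"
        using prob_measuresD(3)[OF R] by (auto simp: prob_measures_def)
      then have "prob_space (power_measure r m)"
        unfolding power_measure_def by (intro prob_space_PiM)
      then show "emeasure (power_measure r m) (space (power_measure r m)) \<le> ennreal 1"
        by (simp add: prob_space.emeasure_space_1)
    qed
    ultimately show ?thesis
      unfolding mixture_eq_bind[OF T R] g_def
      using b measurable_prob_algebraD[OF measurable_power_measure[OF T R]] finite_measure_axioms
      by (intro integral_bind[where K="borel_of ?S" and B=b and B'=1]) auto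
  qed
  have g_cont: "continuous_map ?W euclideanreal g"
    using continuous_map_compose[OF continuous_map_PiM[OF T I] continuous_map_integral[of "product_topology (\<lambda>_. T) {i. enat i < m}" f]] f
    by (simp add: g_def[abs_def] power_measure_def power_topology_def o_def)
  moreover have "bounded (g ` topspace ?W)"
  proof -
    have "\<bar>g r\<bar> \<le> b" if r: "r \<in> prob_measures T" for r
    proof -
      have PM: "power_measure r m \<in> prob_measures ?S"
        unfolding power_measure_def power_topology_def by (rule PiM_prob_measures[OF T(2) I r])
      interpret prob_space "power_measure r m" by (rule prob_measuresD(1)[OF PM])
      have "\<bar>g r\<bar> \<le> (\<integral>x. \<bar>f x\<bar> \<partial>power_measure r m)"
        unfolding g_def by (rule integral_abs_bound)
      also have "\<dots> \<le> (\<integral>x. b \<partial>power_measure r m)"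
        using b prob_measuresD(3)[OF PM] bounded_continuous_integrable[OF PM] f
        by (intro integral_mono) auto
      finally show ?thesis by (simp add: prob_space)
    qed
    then show ?thesis by (auto simp: bounded_iff)
  qed
  ultimately have "((\<lambda>i. \<integral>r. g r \<partial>Q i) \<longlongrightarrow> (\<integral>r. g r \<partial>return (borel_of ?W) p)) F"
    using lim unfolding limitin_weak_topology by blast
  moreover have "(\<integral>r. g r \<partial>return (borel_of ?W) p) = g p"
    using p by (intro integral_return continuous_map_borel_measurable[OF g_cont]) simp
  ultimately have "((\<lambda>i. \<integral>r. g r \<partial>Q i) \<longlongrightarrow> g p) F"
    by simp
  then have "((\<lambda>i. \<integral>x. f x \<partial>mixture T m (Q i)) \<longlongrightarrow> g p) F"
    by (rule Lim_transform_eventually) (use ev in eventually_elim, simp only: int)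
  then show "((\<lambda>i. \<integral>x. f x \<partial>mixture T m (Q i)) \<longlongrightarrow> (\<integral>x. f x \<partial>power_measure p m)) F"
    by (simp only: g_def)
qed

section \<open>The filtration of the coordinates and the posterior\<close>

lemma second_countable_euclidean:
  "second_countable (euclidean :: 'a::second_countable_topology topology)"
proof -
  obtain \<B> :: "'a set set" where \<B>: "countable \<B>" "topological_basis \<B>"
    using ex_countable_basis by blast
  have "\<exists>V\<in>\<B>. x \<in> V \<and> V \<subseteq> U" if "openin euclidean U \<and> x \<in> U" for U x
    using topological_basisE[OF \<B>(2), of U x] that by (metis open_openin)
  moreover have "openin euclidean V" if "V \<in> \<B>" for V
    using topological_basis_open[OF \<B>(2) that] open_openin by blast
  ultimately show ?thesis
    unfolding second_countable_def using \<B>(1) by (intro exI[of _ \<B>]) simp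
qed

lemma sets_power_topology:
  assumes "second_countable T"
  shows "sets (borel_of (power_topology T m)) = sets (PiM {i. enat i < m} (\<lambda>_. borel_of T))"
  unfolding power_topology_def by (rule sets_borel_of_product_topology[OF assms]) simp

text \<open>The stages increase because restriction to the first \<open>m\<close> coordinates
  factors through restriction to the first \<open>n\<close>. They generate everything because each
  single coordinate is already seen at a finite stage.\<close>

lemma coordinate_filtration:
  fixes M :: "(nat \<Rightarrow> 'a) measure" and T :: "'a topology" and F :: "nat \<Rightarrow> (nat \<Rightarrow> 'a) measure"
  assumes T: "second_countable T" and M: "sets M = sets (borel_of (power_topology T \<infinity>))"
    and F_def: "\<And>n. F n = vimage_algebra (space M) (\<lambda>x. restrict x {..<n}) (borel_of (power_topology T (enat n)))"
  shows "subalgebra M (F n)" and "m \<le> n \<Longrightarrow> sets (F m) \<subseteq> sets (F n)"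
    and "sets M = sigma_sets (space M) (\<Union>n. sets (F n))"
proof -
  let ?N = "\<lambda>n. borel_of (power_topology T (enat n))"
  let ?Z = "\<lambda>n x. restrict x {..<n} :: nat \<Rightarrow> 'a"
  have N: "sets (?N n) = sets (PiM {..<n} (\<lambda>_. borel_of T))" for n
    by (simp add: sets_power_topology[OF T] lessThan_def)
  have M': "sets M = sets (PiM UNIV (\<lambda>_. borel_of T))"
    by (simp add: M sets_power_topology[OF T])
  have space_F: "space (F n) = space M" for n
    by (simp add: F_def)
  have "?Z n \<in> PiM UNIV (\<lambda>_. borel_of T) \<rightarrow>\<^sub>M PiM {..<n} (\<lambda>_. borel_of T)" for n
    by (rule measurable_restrict_subset) simp
  then have Z: "?Z n \<in> M \<rightarrow>\<^sub>M ?N n" for n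
    by (simp cong: measurable_cong_sets add: M' N)
  show sub: "subalgebra M (F n)" for n
    using Z[of n] unfolding subalgebra_def space_F by (simp add: F_def measurable_iff_sets)
  show mono: "sets (F m) \<subseteq> sets (F n)" if "m \<le> n" for m n
  proof -
    have "?Z n \<in> F n \<rightarrow>\<^sub>M ?N n"
      unfolding F_def using measurable_space[OF Z] by (intro measurable_vimage_algebra1) auto
    moreover have "?Z m \<in> ?N n \<rightarrow>\<^sub>M ?N m"
    proof -
      have "?Z m \<in> PiM {..<n} (\<lambda>_. borel_of T) \<rightarrow>\<^sub>M PiM {..<m} (\<lambda>_. borel_of T)"
        using that by (intro measurable_restrict_subset) simp
      then show ?thesis
        by (simp cong: measurable_cong_sets add: N)
    qed
    ultimately have "(\<lambda>x. ?Z m (?Z n x)) \<in> F n \<rightarrow>\<^sub>M ?N m"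
      by (rule measurable_compose)
    also have "(\<lambda>x. ?Z m (?Z n x)) = ?Z m"
      using that by (auto simp: restrict_def fun_eq_iff)
    finally have "?Z m \<in> F n \<rightarrow>\<^sub>M ?N m" .
    then show ?thesis
      unfolding measurable_iff_sets by (simp add: F_def)
  qed
  show "sets M = sigma_sets (space M) (\<Union>n. sets (F n))"
  proof
    show "sigma_sets (space M) (\<Union>n. sets (F n)) \<subseteq> sets M"
      using sub by (intro sets.sigma_sets_subset) (auto simp: subalgebra_def)
    define G where "G = sigma (space M) (\<Union>n. sets (F n))"
    have FM: "(\<Union>n. sets (F n)) \<subseteq> Pow (space M)"
      using sets.space_closed space_F by blast
    have G: "space G = space M" "sets G = sigma_sets (space M) (\<Union>n. sets (F n))"
      unfolding G_def using FM by (rule space_measure_of, rule sets_measure_of)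
    have coord: "(\<lambda>x. x i) \<in> G \<rightarrow>\<^sub>M borel_of T" for i
    proof -
      \<comment> \<open>Coordinates are numbered from 0, so coordinate \<open>i\<close> first
        becomes visible at stage \<open>Suc i\<close>.\<close>
      have "?Z (Suc i) \<in> F (Suc i) \<rightarrow>\<^sub>M ?N (Suc i)"
        unfolding F_def using measurable_space[OF Z] by (intro measurable_vimage_algebra1) auto
      then have "?Z (Suc i) \<in> F (Suc i) \<rightarrow>\<^sub>M PiM {..<Suc i} (\<lambda>_. borel_of T)"
        by (simp cong: measurable_cong_sets add: N)
      moreover have "(\<lambda>y. y i) \<in> PiM {..<Suc i} (\<lambda>_. borel_of T) \<rightarrow>\<^sub>M borel_of T"
        by (rule measurable_component_singleton) simp
      ultimately have "(\<lambda>x. ?Z (Suc i) x i) \<in> F (Suc i) \<rightarrow>\<^sub>M borel_of T"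
        by (rule measurable_compose)
      then have "(\<lambda>x. x i) \<in> F (Suc i) \<rightarrow>\<^sub>M borel_of T"
        by simp
      moreover have "sets (F (Suc i)) \<subseteq> sets G"
        unfolding G by (auto intro: sigma_sets.Basic)
      ultimately show ?thesis
        by (auto simp: measurable_def space_F G(1))
    qed
    have space: "space M = UNIV \<rightarrow>\<^sub>E topspace T"
      using sets_eq_imp_space_eq[OF M'] by (simp add: space_PiM)
    have id: "(\<lambda>x i. x i) \<in> G \<rightarrow>\<^sub>M PiM UNIV (\<lambda>_. borel_of T)"
      by (rule measurable_PiM_single'[OF coord]) (simp add: G(1) space)
    show "sets M \<subseteq> sigma_sets (space M) (\<Union>n. sets (F n))"
    proof
      fix A assume A: "A \<in> sets M"
      then have "(\<lambda>x i. x i) -` A \<inter> space G \<in> sets G"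
        using measurable_sets[OF id] M' by simp
      then show "A \<in> sigma_sets (space M) (\<Union>n. sets (F n))"
        using sets.sets_into_space[OF A] by (simp add: G Int_absorb2)
    qed
  qed
qed

theorem theorem2:
  fixes X :: "'a::polish_space set"
    and T :: "'a topology"
    and q :: "'a measure measure"
    and \<rho> :: "(nat \<Rightarrow> 'a) measure"
    and ptilde :: "(nat \<Rightarrow> 'a) \<Rightarrow> 'a measure"
    and post :: "nat \<Rightarrow> (nat \<Rightarrow> 'a) \<Rightarrow> 'a measure measure"
    and dd :: "'a measure measure \<Rightarrow> 'a measure measure \<Rightarrow> real"
    and d :: "enat \<Rightarrow> (nat \<Rightarrow> 'a) measure \<Rightarrow> (nat \<Rightarrow> 'a) measure \<Rightarrow> real"
  assumes X: "X \<in> sets borel"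
    and T: "T = top_of_set X"
    and q: "q \<in> prob_measures (weak_topology T)"
    and \<rho>: "\<rho> = mixture T \<infinity> q"
    and ptilde_measurable: "ptilde \<in> \<rho> \<rightarrow>\<^sub>M borel_of (weak_topology T)"
    and ptilde_distr: "distr \<rho> (borel_of (weak_topology T)) ptilde = q"
    and ptilde_lim:
      "AE x in \<rho>. limitin (weak_topology T) (\<lambda>n. empirical T n x) (ptilde x) sequentially"
    and post: "\<And>n. n \<ge> 1 \<Longrightarrow>
      regular_cond_distr \<rho> (borel_of (power_topology T n)) (\<lambda>x. restrict x {..<n})
        (borel_of (weak_topology T)) ptilde (post n)"
    and dd: "metrizes dd (weak_topology (weak_topology T))"
    and d: "\<And>m. metrizes (d m) (weak_topology (power_topology T m))"
  shows "(AE x in \<rho>.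
            (\<lambda>n. dd (post n (restrict x {..<n}))
                     (return (borel_of (weak_topology T)) (empirical T n x)))
              \<longlonglongrightarrow> 0) \<and>
         (\<forall>m. AE x in \<rho>.
            (\<lambda>n. d m (mixture T m (post n (restrict x {..<n})))
                      (power_measure (empirical T n x) m))
              \<longlonglongrightarrow> 0)"
proof -
  let ?W = "weak_topology T"
  let ?Z = "\<lambda>n x. restrict x {..<n} :: nat \<Rightarrow> 'a"
  define F where "F n = vimage_algebra (space \<rho>) (?Z n) (borel_of (power_topology T (enat n)))" for n
  have metr: "metrizable_space T"
    unfolding T by (intro metrizable_space_subtopology metrizable_space_euclidean)
  have sc: "second_countable T"
    unfolding T by (intro second_countable_subtopology second_countable_euclidean)
  have sets_\<rho>: "sets \<rho> = sets (borel_of (power_topology T \<infinity>))"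
    unfolding \<rho> mixture_def using sets.sets_measure_of_eq[of "borel_of (power_topology T \<infinity>)"] by simp
  have space_\<rho>: "space \<rho> = topspace (power_topology T \<infinity>)"
    using sets_eq_imp_space_eq[OF sets_\<rho>] by simp
  \<comment> \<open>Total mass 1 is inherited from \<open>q\<close>, the image of
    \<open>\<rho>\<close> under \<open>ptilde\<close>.\<close>
  interpret prob_space \<rho>
    by (rule prob_space_distrD[OF ptilde_measurable], unfold ptilde_distr) (rule prob_measuresD(1)[OF q])
  note filtration = coordinate_filtration[OF sc sets_\<rho> F_def]
  obtain \<B> where \<B>: "countable \<B>" "\<And>V. V \<in> \<B> \<Longrightarrow> openin ?W V"
    "\<And>U p. openin ?W U \<Longrightarrow> p \<in> U \<Longrightarrow> \<exists>V\<in>\<B>. p \<in> V \<and> V \<subseteq> U"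
    by (rule second_countableE[OF second_countable_weak_topology[OF metr sc]]) blast
  have post_PM: "post n (?Z n x) \<in> prob_measures ?W" if n: "n \<ge> 1" and x: "x \<in> space \<rho>" for n x
  proof -
    have "?Z n x \<in> space (borel_of (power_topology T (enat n)))"
      using x unfolding space_\<rho> by (simp add: power_topology_def PiE_iff lessThan_def)
    moreover have "post n \<in> borel_of (power_topology T (enat n)) \<rightarrow>\<^sub>M prob_algebra (borel_of ?W)"
      by (rule conjunct1[OF post[OF n, unfolded regular_cond_distr_def]])
    ultimately have "post n (?Z n x) \<in> space (prob_algebra (borel_of ?W))"
      by (rule measurable_space[rotated])
    then show ?thesis
      by (simp add: space_prob_algebra prob_measures_def)
  qed
  have V_lim: "AE x in \<rho>. (\<lambda>n. measure (post n (?Z n x)) V) \<longlonglongrightarrow> indicator V (ptilde x)" if V: "V \<in> \<B>" for V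
  proof -
    let ?A = "ptilde -` V \<inter> space \<rho>"
    have V_sets: "V \<in> sets (borel_of ?W)"
      by (rule openin_sets_borel_of[OF \<B>(2)[OF V]])
    then have A: "?A \<in> sets \<rho>"
      by (rule measurable_sets[OF ptilde_measurable])
    have "AE x in \<rho>. (\<lambda>n. real_cond_exp \<rho> (F n) (indicator ?A) x) \<longlonglongrightarrow> indicator ?A x"
      by (rule Levy_zero_one[OF _ _ filtration(3) A]) (fact filtration(1), rule filtration(2))
    \<comment> \<open>Each \<open>n\<close> brings its own null set, and countably many are merged
      here. The hypothesis on \<open>post\<close> starts at 1, and the missing index 0 does not
      affect the limit.\<close>
    moreover have "AE x in \<rho>. \<forall>n\<in>{1..}. measure (post n (?Z n x)) V = real_cond_exp \<rho> (F n) (indicator ?A) x"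
    proof (rule AE_ball_countable')
      fix n :: nat assume "n \<in> {1..}"
      then have "n \<ge> 1" by simp
      from bspec[OF conjunct2[OF post[OF this, unfolded regular_cond_distr_def]] V_sets]
      show "AE x in \<rho>. measure (post n (?Z n x)) V = real_cond_exp \<rho> (F n) (indicator ?A) x"
        by (simp only: F_def)
    qed simp
    ultimately show ?thesis
      using AE_space
    proof eventually_elim
      case (elim x)
      have "eventually (\<lambda>n. real_cond_exp \<rho> (F n) (indicator ?A) x = measure (post n (?Z n x)) V) sequentially"
        using eventually_ge_at_top[of 1] by eventually_elim (use elim(2) in simp)
      with elim(1) have "(\<lambda>n. measure (post n (?Z n x)) V) \<longlonglongrightarrow> indicator ?A x"
        by (rule Lim_transform_eventually)
      moreover have "indicator ?A x = (indicator V (ptilde x) :: real)"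
        using elim(3) by (simp add: indicator_def)
      ultimately show ?case by simp
    qed
  qed
  have "AE x in \<rho>. \<forall>V\<in>\<B>. (\<lambda>n. measure (post n (?Z n x)) V) \<longlonglongrightarrow> indicator V (ptilde x)"
    by (rule AE_ball_countable'[OF V_lim \<B>(1)])
  then have post_lim: "AE x in \<rho>. limitin (weak_topology ?W) (\<lambda>n. post n (?Z n x))
      (return (borel_of ?W) (ptilde x)) sequentially"
    using AE_space
  proof eventually_elim
    case (elim x)
    show ?case
    proof (rule limitin_weak_topology_returnI[OF \<B>(3)])
      show "ptilde x \<in> topspace ?W"
        using measurable_space[OF ptilde_measurable elim(2)] by simp
      show "eventually (\<lambda>n. post n (?Z n x) \<in> prob_measures ?W) sequentially"
        using eventually_ge_at_top[of 1] by eventually_elim (rule post_PM[OF _ elim(2)])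
      show "(\<lambda>n. measure (post n (?Z n x)) V) \<longlonglongrightarrow> 1" if "V \<in> \<B>" "ptilde x \<in> V" for V
        using elim(1) that by fastforce
    qed
  qed
  have "AE x in \<rho>. (\<lambda>n. dd (post n (?Z n x)) (return (borel_of ?W) (empirical T n x))) \<longlonglongrightarrow> 0"
    using post_lim ptilde_lim
    by eventually_elim (rule metrizes_tendsto[OF dd _ limitin_weak_topology_return])
  \<comment> \<open>The exceptional set is the one of \<open>post_lim\<close> and
    \<open>ptilde_lim\<close>, whatever \<open>m\<close> is; beyond it the argument is
    deterministic.\<close>
  moreover have "AE x in \<rho>. (\<lambda>n. d m (mixture T m (post n (?Z n x))) (power_measure (empirical T n x) m)) \<longlonglongrightarrow> 0" for m
    using post_lim ptilde_lim
  proof eventually_elim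
    case (elim x)
    have "ptilde x \<in> prob_measures T"
      using elim(2) by (simp add: limitin_weak_topology)
    then have "limitin (weak_topology (power_topology T m)) (\<lambda>n. mixture T m (post n (?Z n x)))
        (power_measure (ptilde x) m) sequentially"
      by (rule limitin_mixture[OF metr sc elim(1)])
    moreover have "limitin (weak_topology (power_topology T m)) (\<lambda>n. power_measure (empirical T n x) m)
        (power_measure (ptilde x) m) sequentially"
      unfolding power_topology_def power_measure_def by (rule limitin_PiM[OF metr sc _ elim(2)]) simp
    ultimately show ?case
      by (rule metrizes_tendsto[OF d])
  qed
  ultimately show ?thesis by blast
qed

end
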